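(* Let $\mathcal U=(U_i)_{i\in I}$ be an open covering of a manifold $N$ and $\mathbf G\xrightarrow{\rho}\mathbf H$ a crossed module of Lie groups. Let $(\mathcal U,\bullet,\star)$ and $(\mathcal U,\bullet',\star')$ be two adapted Lie groupoid $\mathbf G\to\mathbf H$-extensions of the Čech groupoid $N[\mathcal U]$, and let $(\lambda,\mathbf g)$ and $(\lambda',\mathbf g')$ be the $\mathbf G\to\mathbf H$-valued non-Abelian $1$-cocycles w.r.t. $\mathcal U$ associated with $(\mathcal U,\bullet,\star)$ and $(\mathcal U,\bullet',\star')$ respectively. Then the following constructions define a one-to-one correspondence between the set of isomorphisms of Lie groupoid $\mathbf G\to\mathbf H$-extensions of $N[\mathcal U]$ from $(\mathcal U,\bullet,\star)$ to $(\mathcal U,\bullet',\star')$ and the set of $\mathbf G\to\mathbf H$-valued $1$-coboundaries relating $(\lambda,\mathbf g)$ and $(\lambda',\mathbf g')$: (1) Given an isomorphism $(\Phi_{\mathcal R},\Phi_P)$ of Lie groupoid $\mathbf G\to\mathbf H$-extensions of $N[\mathcal U]$ from $(\mathcal U,\bullet,\star)$ to $(\mathcal U,\bullet',\star')$, define $r_i:U_i\to\mathbf H$ and $\mathbf v_{ij}:U_{ij}\to\mathbf G$ by $$(x_i,r_i(x))=\Phi_P(x_i,e),\qquad (\mathbf v_{ij}(x)^{-1},x_{ij})=\Phi_{\mathcal R}(e,x_{ij}).$$ (2) Given a $\mathbf G\to\mathbf H$-valued $1$-coboundary $(r,\mathbf v)$ relating $(\lambda,\mathbf g)$ and $(\lambda',\mathbf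 g')$, define an isomorphism $(\Phi_{\mathcal R},\Phi_P)$ from $(\mathcal U,\bullet,\star)$ to $(\mathcal U,\bullet',\star')$ by $$\Phi_{\mathcal R}(g,x_{ij})=(r_i(g)\,\mathbf v_{ij}^{-1},x_{ij}),\qquad \Phi_P(x_i,h)=(x_i,r_ih)$$ for all $i,j\in I$, $x\in U_{ij}$ (resp. $x\in U_i$), $g\in\mathbf G$, $h\in\mathbf H$, where $r_i,\mathbf v_{ij}$ are evaluated at $x$ and $r_i(g)$ denotes the action of $r_i(x)\in\mathbf H$ on $g$.
   Context: **Crossed module.** A crossed module of (finite-dimensional) Lie groups $\mathbf G\xrightarrow{\rho}\mathbf H$ consists of Lie groups $\mathbf G,\mathbf H$ and Lie group homomorphisms $\rho:\mathbf G\to\mathbf H$ and $j:\mathbf H\to\mathrm{Aut}(\mathbf G)$ such that, writing $h(g):=j(h)(g)$, one has $\rho(h(g))=h\rho(g)h^{-1}$ and $\rho(g)(g')=gg'g^{-1}$ for all $g,g'\in\mathbf G$, $h\in\mathbf H$. The neutral elements of $\mathbf G$ and $\mathbf H$ are both denoted $e$. **Lie groupoids.** In a Lie groupoid $\Gamma\rightrightarrows M$ with source $s$, target $t$ and unit map $\epsilon$, the product $xx'$ is defined when $t(x)=s(x')$. A left action of $\Gamma\rightrightarrows M$ on a surjective submersion $\pi:P\to M$ is a smooth map $\Gamma\times_{t,M,\pi}P\to P$, $(\gamma,p)\mapsto\gamma\cdot p$, with $\pi(\gamma\cdot p)=s(\gamma)$, compatible with products and units. **Čech groupoid.** For an open cover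 $\mathcal U=(U_i)_{i\in I}$ of $N$, put $U_{ij}=U_i\cap U_j$, $U_{ijk}=U_i\cap U_j\cap U_k$; $x_i$ (resp. $x_{ij}$) denotes $x$ seen as an element of the component $U_i$ (resp. $U_{ij}$) of a disjoint union indexed by $I$ (resp. by ordered pairs). The Čech groupoid $N[\mathcal U]$ is $\coprod_{i,j}U_{ij}\rightrightarrows\coprod_iU_i$ with $s(x_{ij})=x_i$, $t(x_{ij})=x_j$, $x_{ij}\bullet x_{jk}=x_{ik}$, unit $x_i\mapsto x_{ii}$, inverse $x_{ij}^{-1}=x_{ji}$. **Extensions.** A Lie groupoid extension $\mathcal R\xrightarrow{\phi}\mathcal G$ consists of Lie groupoids $\mathcal R,\mathcal G$ over the same manifold $M$ and a groupoid morphism $\phi$ over $\mathrm{id}_M$ which is a surjective submersion. Its kernel is $K=\phi^{-1}(\epsilon(M))$, a bundle of Lie groups over $M$. It is a Lie groupoid $\mathbf G$-extension if $K$ is a locally trivial bundle of Lie groups with typical fiber $\mathbf G$. Its band is $\mathrm{Band}(\mathcal R\to\mathcal G)=\coprod_{m\in M}\mathrm{Isom}(\mathbf G,K_m)$ (Lie group isomorphisms), with its natural structure of principal right $\mathrm{Aut}(\mathbf G)$-bundle over $M$ ($b\cdot\alpha=b\circ\alpha$), on which $\mathcal R$ acts on the left by $(r\cdot b)(g)=r\,b(g)\,r^{-1}$ for $b\in\mathrm{Isom}(\mathbf G,K_{t(r)})$. A principal $\mathbf H$-bundle over a Lie groupoid $\mathcal R\rightrightarrows M$ is a (right) principal $\mathbf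 H$-bundle $P\xrightarrow{\pi} M$ with a left action of $\mathcal R\rightrightarrows M$ commuting with the $\mathbf H$-action. A Lie groupoid $\mathbf G\to\mathbf H$-extension of $\mathcal G\rightrightarrows M$ is a triple $(\mathcal R\to\mathcal G,P\to M,\chi)$ where $\mathcal R\to\mathcal G$ is a Lie groupoid $\mathbf G$-extension, $P\to M$ is a principal $\mathbf H$-bundle over $\mathcal R\rightrightarrows M$, and $\chi:P\to\mathrm{Band}(\mathcal R\to\mathcal G)$ is a smooth map over $\mathrm{id}_M$ with $\chi(r\cdot p\cdot h)=r\cdot\chi(p)\cdot j(h)$, such that $p\cdot\rho(g)=\chi(p)(g)\cdot p$ for all $p\in P,g\in\mathbf G$. An isomorphism of $\mathbf G\to\mathbf H$-extensions of $\mathcal G\rightrightarrows M$ from $(\mathcal R\xrightarrow{\phi}\mathcal G,P,\chi)$ to $(\mathcal R'\xrightarrow{\phi'}\mathcal G,P',\chi')$ is a pair $(\Phi,\Psi)$ with $\Phi:\mathcal R\to\mathcal R'$ an isomorphism of Lie groupoids over $\mathrm{id}_M$ with $\phi'\circ\Phi=\phi$, and $\Psi:P\to P'$ a diffeomorphism over $\mathrm{id}_M$ with $\Psi(r\cdot p\cdot h)=\Phi(r)\cdot\Psi(p)\cdot h$, such that $\chi'\circ\Psi=\bar\Phi\circ\chi$, where $\bar\Phi(\eta)(g)=\Phi(\eta(g))$ for $\eta$ in the band and $g\in\mathbf G$. **Adapted extensions.** A $\mathbf G\to\mathbf H$-extension $(\mathcal R\xrightarrow{\phi}N[\mathcal U],P\to\coprod_iU_i,\chi)$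 of $N[\mathcal U]$ is adapted if: (1) $\mathcal R=\mathbf G\times\coprod_{i,j}U_{ij}$ as a manifold and $\phi$ is the projection on the second component; (2) $P=\coprod_iU_i\times\mathbf H$ with right action $(x_i,h)\cdot h'=(x_i,hh')$; (3) $\chi(x_i,h)$ is the element $g\mapsto(h(g),x_{ii})$ of the band over $x_i$; (4) the product of $\mathcal R$ satisfies $(g,x_{ii})(g',x_{ij})=(gg',x_{ij})$ for all $i,j\in I$, $x\in U_{ij}$, $g,g'\in\mathbf G$. It is denoted $(\mathcal U,\bullet,\star)$, where $\bullet$ is the product of $\mathcal R$ and $\star$ the action of $\mathcal R$ on $P$. **Cocycles.** A $\mathbf G\to\mathbf H$-valued non-Abelian $1$-cocycle w.r.t. $\mathcal U$ is a pair $(\lambda,\mathbf g)\in C^\infty(\coprod_{i,j}U_{ij},\mathbf H)\times C^\infty(\coprod_{i,j,k}U_{ijk},\mathbf G)$ with, for all indices, $\rho(\mathbf g_{ijk})\lambda_{ik}=\lambda_{ij}\lambda_{jk}$, $\mathbf g_{ijk}\mathbf g_{ikl}=\lambda_{ij}(\mathbf g_{jkl})\mathbf g_{ijl}$, $\mathbf g_{iij}=e$. The cocycle associated with an adapted extension $(\mathcal U,\bullet,\star)$ is defined by $(e,x_{ij})\star(x_j,e)=(x_i,\lambda_{ij}(x))$ and $(e,x_{ij})\bullet(e,x_{jk})=(\mathbf g_{ijk}(x),x_{ik})$; this assignment is a bijection between adapted extensions of $N[\mathcal U]$ and cocycles w.r.t. $\mathcal U$, with inverse given by $(g,x_{ij})\bullet(g',x_{jk})=(g\lambda_{ij}(g')\mathbf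 g_{ijk},x_{ik})$, $(g,x_{ij})\star(x_j,h)=(x_i,\rho(g)\lambda_{ij}h)$. **Coboundaries.** A $\mathbf G\to\mathbf H$-valued $1$-coboundary is a pair $(r,\mathbf v)\in C^\infty(\coprod_iU_i,\mathbf H)\times C^\infty(\coprod_{i,j}U_{ij},\mathbf G)$. It relates $(\lambda,\mathbf g)$ and $(\lambda',\mathbf g')$ if, for all indices, $\lambda'_{ij}=\rho(\mathbf v_{ij})\,r_i\,\lambda_{ij}\,r_j^{-1}$ and $\mathbf g'_{ijk}\mathbf v_{ik}=\lambda'_{ij}(\mathbf v_{jk})\,\mathbf v_{ij}\,r_i(\mathbf g_{ijk})$. *)

theory Defs
  imports "HOL-Analysis.Analysis" "HOL-Algebra.Bij"
begin

section \<open>Smooth manifolds\<close>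

primrec Ck_on :: "nat \<Rightarrow> 'a::real_normed_vector set \<Rightarrow> ('a \<Rightarrow> 'b::real_normed_vector) \<Rightarrow> bool" where
  "Ck_on 0 S f \<longleftrightarrow> continuous_on S f"
| "Ck_on (Suc k) S f \<longleftrightarrow> (\<forall>x\<in>S. f differentiable (at x)) \<and>
     (\<forall>v. Ck_on k S (\<lambda>x. frechet_derivative f (at x) v))"

text \<open>Only used for open \<open>S\<close> in a finite-dimensional space, where this is the usual \<open>C\<^sup>\<infinity>\<close>.\<close>

definition smooth_on :: "'a::real_normed_vector set \<Rightarrow> ('a \<Rightarrow> 'b::real_normed_vector) \<Rightarrow> bool" where
  "smooth_on S f \<longleftrightarrow> (\<forall>k. Ck_on k S f)"

text \<open>
  A manifold is presented by a topology and a (not necessarily maximal) smooth atlas of charts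
  \<open>(U, \<phi>)\<close> with values in a finite-dimensional normed space. The model space is not required to
  be in class \<open>euclidean_space\<close>, because that class has no space of dimension \<open>0\<close> and so
  would exclude discrete Lie groups, for instance a trivial \<open>H\<close>.
  Second countability is not imposed: it fails for disjoint unions over arbitrary index sets.
\<close>

record ('a, 'e) mfd =
  mtop :: "'a topology"
  atlas :: "('a set \<times> ('a \<Rightarrow> 'e)) set"

abbreviation pts :: "('a, 'e) mfd \<Rightarrow> 'a set" where
  "pts M \<equiv> topspace (mtop M)"

definition manifold :: "('a, 'e::real_normed_vector) mfd \<Rightarrow> bool" where
  "manifold M \<longleftrightarrow>
     (\<exists>B::'e set. finite B \<and> span B = UNIV) \<and>
     Hausdorff_space (mtop M) \<and>
     pts M = (\<Union>(U, \<phi>)\<in>atlas M. U) \<and>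
     (\<forall>(U, \<phi>)\<in>atlas M. openin (mtop M) U \<and> open (\<phi> ` U) \<and>
        homeomorphic_map (subtopology (mtop M) U) (top_of_set (\<phi> ` U)) \<phi>) \<and>
     (\<forall>(U, \<phi>)\<in>atlas M. \<forall>(V, \<psi>)\<in>atlas M.
        smooth_on (\<phi> ` (U \<inter> V)) (\<psi> \<circ> inv_into U \<phi>))"

definition smooth_map ::
  "('a, 'd::real_normed_vector) mfd \<Rightarrow> ('b, 'e::real_normed_vector) mfd \<Rightarrow> ('a \<Rightarrow> 'b) \<Rightarrow> bool" where
  "smooth_map M N f \<longleftrightarrow>
     continuous_map (mtop M) (mtop N) f \<and>
     (\<forall>(U, \<phi>)\<in>atlas M. \<forall>(V, \<psi>)\<in>atlas N.
        smooth_on (\<phi> ` {x\<in>U. f x \<in> V}) (\<psi> \<circ> f \<circ> inv_into U \<phi>))"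

definition diffeo ::
  "('a, 'd::real_normed_vector) mfd \<Rightarrow> ('b, 'e::real_normed_vector) mfd \<Rightarrow> ('a \<Rightarrow> 'b) \<Rightarrow> bool" where
  "diffeo M N f \<longleftrightarrow> bij_betw f (pts M) (pts N) \<and> smooth_map M N f \<and>
     smooth_map N M (inv_into (pts M) f)"

definition submersion ::
  "('a, 'd::real_normed_vector) mfd \<Rightarrow> ('b, 'e::real_normed_vector) mfd \<Rightarrow> ('a \<Rightarrow> 'b) \<Rightarrow> bool" where
  "submersion M N f \<longleftrightarrow> smooth_map M N f \<and>
     (\<forall>(U, \<phi>)\<in>atlas M. \<forall>(V, \<psi>)\<in>atlas N. \<forall>x\<in>U. f x \<in> V \<longrightarrow>
        surj (frechet_derivative (\<psi> \<circ> f \<circ> inv_into U \<phi>) (at (\<phi> x))))"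

definition surj_submersion ::
  "('a, 'd::real_normed_vector) mfd \<Rightarrow> ('b, 'e::real_normed_vector) mfd \<Rightarrow> ('a \<Rightarrow> 'b) \<Rightarrow> bool" where
  "surj_submersion M N f \<longleftrightarrow> submersion M N f \<and> f ` pts M = pts N"

text \<open>Equality of smooth structures, i.e. of the maximal atlases generated.\<close>

definition same_manifold ::
  "('a, 'd::real_normed_vector) mfd \<Rightarrow> ('a, 'e::real_normed_vector) mfd \<Rightarrow> bool" where
  "same_manifold M N \<longleftrightarrow> mtop M = mtop N \<and> smooth_map M N (\<lambda>x. x) \<and> smooth_map N M (\<lambda>x. x)"

definition open_sub :: "('a, 'e) mfd \<Rightarrow> 'a set \<Rightarrow> ('a, 'e) mfd" where
  "open_sub M W = \<lparr>mtop = subtopology (mtop M) W, atlas = {(U \<inter> W, \<phi>) | U \<phi>. (U, \<phi>) \<in> atlas M}\<rparr>"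

definition prod_mfd :: "('a, 'd) mfd \<Rightarrow> ('b, 'e) mfd \<Rightarrow> ('a \<times> 'b, 'd \<times> 'e) mfd" where
  "prod_mfd M N = \<lparr>mtop = prod_topology (mtop M) (mtop N),
     atlas = {(U \<times> V, map_prod \<phi> \<psi>) | U \<phi> V \<psi>. (U, \<phi>) \<in> atlas M \<and> (V, \<psi>) \<in> atlas N}\<rparr>"

text \<open>The disjoint union of the open submanifolds \<open>W k\<close> of \<open>M\<close>, \<open>k \<in> K\<close>; the point \<open>x\<close>
  of \<open>W k\<close>, seen in the component with index \<open>k\<close>, is \<open>(k, x)\<close>.\<close>

definition disj_union :: "('a, 'e) mfd \<Rightarrow> 'k set \<Rightarrow> ('k \<Rightarrow> 'a set) \<Rightarrow> ('k \<times> 'a, 'e) mfd" where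
  "disj_union M K W = \<lparr>mtop = sum_topology (\<lambda>k. subtopology (mtop M) (W k)) K,
     atlas = {({k} \<times> (U \<inter> W k), \<phi> \<circ> snd) | k U \<phi>. k \<in> K \<and> (U, \<phi>) \<in> atlas M}\<rparr>"

text \<open>Smoothness on a subset \<open>S\<close>, by local extension. It is only used for embedded submanifolds
  (fibre products along submersions, kernels of extensions, and fibres of such kernels), where it
  coincides with smoothness for the submanifold structure.\<close>

definition smooth_map_on ::
  "('a, 'd::real_normed_vector) mfd \<Rightarrow> 'a set \<Rightarrow> ('b, 'e::real_normed_vector) mfd \<Rightarrow> ('a \<Rightarrow> 'b) \<Rightarrow> bool" where
  "smooth_map_on M S N f \<longleftrightarrow>
     (\<forall>p\<in>S. \<exists>W F. openin (mtop M) W \<and> p \<in> W \<and> smooth_map (open_sub M W) N F \<and>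
        (\<forall>q\<in>S \<inter> W. F q = f q))"

text \<open>\<open>C\<^sup>\<infinity>(M, N)\<close>; extensionality makes equality of functions equality on \<open>M\<close>.\<close>

definition C_inf ::
  "('a, 'd::real_normed_vector) mfd \<Rightarrow> ('b, 'e::real_normed_vector) mfd \<Rightarrow> ('a \<Rightarrow> 'b) set" where
  "C_inf M N = {f \<in> extensional (pts M). smooth_map M N f}"


section \<open>Lie groups and crossed modules\<close>

record ('g, 'e) lie_grp = "'g monoid" +
  gmfd :: "('g, 'e) mfd"

definition lie_group :: "('g, 'e::real_normed_vector) lie_grp \<Rightarrow> bool" where
  "lie_group G \<longleftrightarrow> group G \<and> manifold (gmfd G) \<and> pts (gmfd G) = carrier G \<and>
     smooth_map (prod_mfd (gmfd G) (gmfd G)) (gmfd G) (\<lambda>(a, b). a \<otimes>\<^bsub>G\<^esub> b) \<and>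
     smooth_map (gmfd G) (gmfd G) (\<lambda>a. inv\<^bsub>G\<^esub> a)"

definition lie_hom ::
  "('g, 'd::real_normed_vector) lie_grp \<Rightarrow> ('h, 'e::real_normed_vector) lie_grp \<Rightarrow> ('g \<Rightarrow> 'h) set" where
  "lie_hom G H = {f \<in> hom G H. smooth_map (gmfd G) (gmfd H) f}"

definition lie_Aut :: "('g, 'e::real_normed_vector) lie_grp \<Rightarrow> ('g \<Rightarrow> 'g) monoid" where
  "lie_Aut G = BijGroup (carrier G) \<lparr>carrier := {a \<in> auto G. diffeo (gmfd G) (gmfd G) a}\<rparr>"

text \<open>A map \<open>f\<close> into \<open>Aut(G)\<close> is smooth iff the evaluation map \<open>(x, g) \<mapsto> f x g\<close> is smooth.
  Below, \<open>act h g\<close> is \<open>h(g) = j(h)(g)\<close>.\<close>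

definition crossed_module ::
  "('g, 'd::real_normed_vector) lie_grp \<Rightarrow> ('h, 'e::real_normed_vector) lie_grp \<Rightarrow>
   ('g \<Rightarrow> 'h) \<Rightarrow> ('h \<Rightarrow> 'g \<Rightarrow> 'g) \<Rightarrow> bool" where
  "crossed_module G H \<rho> act \<longleftrightarrow>
     lie_group G \<and> lie_group H \<and> \<rho> \<in> lie_hom G H \<and>
     act \<in> hom H (lie_Aut G) \<and>
     smooth_map (prod_mfd (gmfd H) (gmfd G)) (gmfd G) (\<lambda>(h, g). act h g) \<and>
     (\<forall>h\<in>carrier H. \<forall>g\<in>carrier G. \<rho> (act h g) = h \<otimes>\<^bsub>H\<^esub> \<rho> g \<otimes>\<^bsub>H\<^esub> inv\<^bsub>H\<^esub> h) \<and>
     (\<forall>g\<in>carrier G. \<forall>g'\<in>carrier G. act (\<rho> g) g' = g \<otimes>\<^bsub>G\<^esub> g' \<otimes>\<^bsub>G\<^esub> inv\<^bsub>G\<^esub> g)"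


section \<open>Lie groupoids\<close>

text \<open>The product \<open>gprod R x y\<close> is meaningful when \<open>tgt R x = src R y\<close>.\<close>

record ('r, 'er, 'm, 'em) groupoid =
  arrows :: "('r, 'er) mfd"
  objects :: "('m, 'em) mfd"
  src :: "'r \<Rightarrow> 'm"
  tgt :: "'r \<Rightarrow> 'm"
  ident :: "'m \<Rightarrow> 'r"
  gprod :: "'r \<Rightarrow> 'r \<Rightarrow> 'r"
  ginv :: "'r \<Rightarrow> 'r"

abbreviation Arr :: "('r, 'er, 'm, 'em) groupoid \<Rightarrow> 'r set" where
  "Arr R \<equiv> pts (arrows R)"

abbreviation Obj :: "('r, 'er, 'm, 'em) groupoid \<Rightarrow> 'm set" where
  "Obj R \<equiv> pts (objects R)"

definition lie_groupoid ::
  "('r, 'er::real_normed_vector, 'm, 'em::real_normed_vector) groupoid \<Rightarrow> bool" where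
  "lie_groupoid R \<longleftrightarrow>
     manifold (arrows R) \<and> manifold (objects R) \<and>
     surj_submersion (arrows R) (objects R) (src R) \<and>
     surj_submersion (arrows R) (objects R) (tgt R) \<and>
     smooth_map (objects R) (arrows R) (ident R) \<and>
     smooth_map (arrows R) (arrows R) (ginv R) \<and>
     smooth_map_on (prod_mfd (arrows R) (arrows R))
       {(x, y) \<in> Arr R \<times> Arr R. tgt R x = src R y} (arrows R) (\<lambda>(x, y). gprod R x y) \<and>
     (\<forall>m\<in>Obj R. src R (ident R m) = m \<and> tgt R (ident R m) = m) \<and>
     (\<forall>x\<in>Arr R. \<forall>y\<in>Arr R. tgt R x = src R y \<longrightarrow>
        gprod R x y \<in> Arr R \<and> src R (gprod R x y) = src R x \<and> tgt R (gprod R x y) = tgt R y) \<and>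
     (\<forall>x\<in>Arr R. \<forall>y\<in>Arr R. \<forall>z\<in>Arr R. tgt R x = src R y \<and> tgt R y = src R z \<longrightarrow>
        gprod R (gprod R x y) z = gprod R x (gprod R y z)) \<and>
     (\<forall>x\<in>Arr R. gprod R (ident R (src R x)) x = x \<and> gprod R x (ident R (tgt R x)) = x) \<and>
     (\<forall>x\<in>Arr R. src R (ginv R x) = tgt R x \<and> tgt R (ginv R x) = src R x \<and>
        gprod R x (ginv R x) = ident R (src R x) \<and> gprod R (ginv R x) x = ident R (tgt R x))"

text \<open>Morphisms of Lie groupoids over the identity of a common base.\<close>

definition groupoid_morphism ::
  "('r, 'er::real_normed_vector, 'm, 'em) groupoid \<Rightarrow>
   ('s, 'es::real_normed_vector, 'm, 'em) groupoid \<Rightarrow> ('r \<Rightarrow> 's) \<Rightarrow> bool" where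
  "groupoid_morphism R S f \<longleftrightarrow>
     objects R = objects S \<and> smooth_map (arrows R) (arrows S) f \<and>
     (\<forall>x\<in>Arr R. src S (f x) = src R x \<and> tgt S (f x) = tgt R x) \<and>
     (\<forall>m\<in>Obj R. f (ident R m) = ident S m) \<and>
     (\<forall>x\<in>Arr R. \<forall>y\<in>Arr R. tgt R x = src R y \<longrightarrow> f (gprod R x y) = gprod S (f x) (f y))"

definition left_action ::
  "('r, 'er::real_normed_vector, 'm, 'em::real_normed_vector) groupoid \<Rightarrow>
   ('p, 'ep::real_normed_vector) mfd \<Rightarrow> ('p \<Rightarrow> 'm) \<Rightarrow> ('r \<Rightarrow> 'p \<Rightarrow> 'p) \<Rightarrow> bool" where
  "left_action R P \<pi> lact \<longleftrightarrow>
     surj_submersion P (objects R) \<pi> \<and>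
     smooth_map_on (prod_mfd (arrows R) P) {(x, p) \<in> Arr R \<times> pts P. tgt R x = \<pi> p} P
       (\<lambda>(x, p). lact x p) \<and>
     (\<forall>x\<in>Arr R. \<forall>p\<in>pts P. tgt R x = \<pi> p \<longrightarrow> lact x p \<in> pts P \<and> \<pi> (lact x p) = src R x) \<and>
     (\<forall>x\<in>Arr R. \<forall>y\<in>Arr R. \<forall>p\<in>pts P. tgt R x = src R y \<and> tgt R y = \<pi> p \<longrightarrow>
        lact (gprod R x y) p = lact x (lact y p)) \<and>
     (\<forall>p\<in>pts P. lact (ident R (\<pi> p)) p = p)"

text \<open>In the Cech groupoid, \<open>x\<^sub>i\<close> is \<open>(i, x)\<close> and \<open>x\<^sub>i\<^sub>j\<close> is \<open>((i, j), x)\<close>.\<close>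

definition open_cover :: "('n, 'en) mfd \<Rightarrow> 'i set \<Rightarrow> ('i \<Rightarrow> 'n set) \<Rightarrow> bool" where
  "open_cover N I U \<longleftrightarrow> (\<forall>i\<in>I. openin (mtop N) (U i)) \<and> (\<Union>i\<in>I. U i) = pts N"

definition cover1 :: "('n, 'en) mfd \<Rightarrow> 'i set \<Rightarrow> ('i \<Rightarrow> 'n set) \<Rightarrow> ('i \<times> 'n, 'en) mfd" where
  "cover1 N I U = disj_union N I U"

definition cover2 :: "('n, 'en) mfd \<Rightarrow> 'i set \<Rightarrow> ('i \<Rightarrow> 'n set) \<Rightarrow> (('i \<times> 'i) \<times> 'n, 'en) mfd" where
  "cover2 N I U = disj_union N (I \<times> I) (\<lambda>(i, j). U i \<inter> U j)"

definition cover3 :: "('n, 'en) mfd \<Rightarrow> 'i set \<Rightarrow> ('i \<Rightarrow> 'n set) \<Rightarrow> (('i \<times> 'i \<times> 'i) \<times> 'n, 'en) mfd" where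
  "cover3 N I U = disj_union N (I \<times> I \<times> I) (\<lambda>(i, j, k). U i \<inter> U j \<inter> U k)"

definition cech ::
  "('n, 'en) mfd \<Rightarrow> 'i set \<Rightarrow> ('i \<Rightarrow> 'n set) \<Rightarrow> (('i \<times> 'i) \<times> 'n, 'en, 'i \<times> 'n, 'en) groupoid" where
  "cech N I U = \<lparr>arrows = cover2 N I U, objects = cover1 N I U,
     src = (\<lambda>((i, j), x). (i, x)), tgt = (\<lambda>((i, j), x). (j, x)),
     ident = (\<lambda>(i, x). ((i, i), x)),
     gprod = (\<lambda>((i, j), x) ((j', k), y). ((i, k), x)),
     ginv = (\<lambda>((i, j), x). ((j, i), x))\<rparr>"


section \<open>Groupoid extensions\<close>

definition lie_groupoid_extension ::
  "('r, 'er::real_normed_vector, 'm, 'em::real_normed_vector) groupoid \<Rightarrow>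
   ('s, 'es::real_normed_vector, 'm, 'em) groupoid \<Rightarrow> ('r \<Rightarrow> 's) \<Rightarrow> bool" where
  "lie_groupoid_extension R S \<phi> \<longleftrightarrow> lie_groupoid R \<and> lie_groupoid S \<and>
     groupoid_morphism R S \<phi> \<and> surj_submersion (arrows R) (arrows S) \<phi>"

definition ext_kernel ::
  "('r, 'er, 'm, 'em) groupoid \<Rightarrow> ('s, 'es, 'm, 'em) groupoid \<Rightarrow> ('r \<Rightarrow> 's) \<Rightarrow> 'r set" where
  "ext_kernel R S \<phi> = {x \<in> Arr R. \<phi> x \<in> ident S ` Obj S}"

definition kernel_fibre ::
  "('r, 'er, 'm, 'em) groupoid \<Rightarrow> ('s, 'es, 'm, 'em) groupoid \<Rightarrow> ('r \<Rightarrow> 's) \<Rightarrow> 'm \<Rightarrow> 'r monoid" where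
  "kernel_fibre R S \<phi> m =
     \<lparr>carrier = {x \<in> Arr R. \<phi> x = ident S m}, mult = gprod R, one = ident R m\<rparr>"

text \<open>The kernel is locally trivial: over an open \<open>W\<close> there is a diffeomorphism \<open>\<tau>\<close> from
  \<open>W \<times> G\<close> to the restriction of the kernel to \<open>W\<close>, which is fibrewise a group isomorphism.\<close>

definition G_extension ::
  "('g, 'eg::real_normed_vector) lie_grp \<Rightarrow>
   ('r, 'er::real_normed_vector, 'm, 'em::real_normed_vector) groupoid \<Rightarrow>
   ('s, 'es::real_normed_vector, 'm, 'em) groupoid \<Rightarrow> ('r \<Rightarrow> 's) \<Rightarrow> bool" where
  "G_extension G R S \<phi> \<longleftrightarrow> lie_groupoid_extension R S \<phi> \<and>
     (\<forall>m\<in>Obj R. \<exists>W \<tau>. openin (mtop (objects R)) W \<and> m \<in> W \<and>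
        bij_betw \<tau> (W \<times> carrier G) {x \<in> ext_kernel R S \<phi>. src R x \<in> W} \<and>
        smooth_map (prod_mfd (open_sub (objects R) W) (gmfd G)) (arrows R) \<tau> \<and>
        smooth_map_on (arrows R) {x \<in> ext_kernel R S \<phi>. src R x \<in> W}
          (prod_mfd (open_sub (objects R) W) (gmfd G)) (inv_into (W \<times> carrier G) \<tau>) \<and>
        (\<forall>w\<in>W. (\<lambda>g. \<tau> (w, g)) \<in> iso G (kernel_fibre R S \<phi> w)))"

text \<open>The fibre \<open>Isom(G, K\<^sub>m)\<close> of the band over \<open>m\<close>.\<close>

definition band_fibre ::
  "('g, 'eg::real_normed_vector) lie_grp \<Rightarrow>
   ('r, 'er::real_normed_vector, 'm, 'em) groupoid \<Rightarrow>
   ('s, 'es, 'm, 'em) groupoid \<Rightarrow> ('r \<Rightarrow> 's) \<Rightarrow> 'm \<Rightarrow> ('g \<Rightarrow> 'r) set" where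
  "band_fibre G R S \<phi> m =
     {b \<in> extensional (carrier G). b \<in> iso G (kernel_fibre R S \<phi> m) \<and>
        smooth_map (gmfd G) (arrows R) b \<and>
        smooth_map_on (arrows R) (carrier (kernel_fibre R S \<phi> m)) (gmfd G) (inv_into (carrier G) b)}"

definition band_lact ::
  "('g, 'eg) lie_grp \<Rightarrow> ('r, 'er, 'm, 'em) groupoid \<Rightarrow> 'r \<Rightarrow> ('g \<Rightarrow> 'r) \<Rightarrow> ('g \<Rightarrow> 'r)" where
  "band_lact G R x b = (\<lambda>g\<in>carrier G. gprod R (gprod R x (b g)) (ginv R x))"

definition band_ract :: "('g, 'eg) lie_grp \<Rightarrow> ('g \<Rightarrow> 'r) \<Rightarrow> ('g \<Rightarrow> 'g) \<Rightarrow> ('g \<Rightarrow> 'r)" where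
  "band_ract G b a = compose (carrier G) b a"

definition principal_bundle ::
  "('h, 'eh::real_normed_vector) lie_grp \<Rightarrow> ('p, 'ep::real_normed_vector) mfd \<Rightarrow>
   ('m, 'em::real_normed_vector) mfd \<Rightarrow> ('p \<Rightarrow> 'm) \<Rightarrow> ('p \<Rightarrow> 'h \<Rightarrow> 'p) \<Rightarrow> bool" where
  "principal_bundle H P M \<pi> ract \<longleftrightarrow>
     manifold P \<and> manifold M \<and> surj_submersion P M \<pi> \<and>
     smooth_map (prod_mfd P (gmfd H)) P (\<lambda>(p, h). ract p h) \<and>
     (\<forall>p\<in>pts P. ract p \<one>\<^bsub>H\<^esub> = p) \<and>
     (\<forall>p\<in>pts P. \<forall>h\<in>carrier H. \<forall>h'\<in>carrier H. ract p (h \<otimes>\<^bsub>H\<^esub> h') = ract (ract p h) h') \<and>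
     (\<forall>p\<in>pts P. \<forall>h\<in>carrier H. \<pi> (ract p h) = \<pi> p) \<and>
     (\<forall>m\<in>pts M. \<exists>W \<tau>. openin (mtop M) W \<and> m \<in> W \<and>
        diffeo (prod_mfd (open_sub M W) (gmfd H)) (open_sub P {p \<in> pts P. \<pi> p \<in> W}) \<tau> \<and>
        (\<forall>w\<in>W. \<forall>h\<in>carrier H. \<pi> (\<tau> (w, h)) = w) \<and>
        (\<forall>w\<in>W. \<forall>h\<in>carrier H. \<forall>h'\<in>carrier H. \<tau> (w, h \<otimes>\<^bsub>H\<^esub> h') = ract (\<tau> (w, h)) h'))"

definition principal_bundle_over_groupoid ::
  "('h, 'eh::real_normed_vector) lie_grp \<Rightarrow>
   ('r, 'er::real_normed_vector, 'm, 'em::real_normed_vector) groupoid \<Rightarrow>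
   ('p, 'ep::real_normed_vector) mfd \<Rightarrow> ('p \<Rightarrow> 'm) \<Rightarrow> ('p \<Rightarrow> 'h \<Rightarrow> 'p) \<Rightarrow> ('r \<Rightarrow> 'p \<Rightarrow> 'p) \<Rightarrow> bool" where
  "principal_bundle_over_groupoid H R P \<pi> ract lact \<longleftrightarrow>
     principal_bundle H P (objects R) \<pi> ract \<and> left_action R P \<pi> lact \<and>
     (\<forall>x\<in>Arr R. \<forall>p\<in>pts P. \<forall>h\<in>carrier H. tgt R x = \<pi> p \<longrightarrow>
        lact x (ract p h) = ract (lact x p) h)"

record ('r, 'er, 'm, 'em, 's, 'g, 'h, 'p, 'ep) gh_ext =
  total :: "('r, 'er, 'm, 'em) groupoid"
  eproj :: "'r \<Rightarrow> 's"
  ptot :: "('p, 'ep) mfd"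
  bproj :: "'p \<Rightarrow> 'm"
  ract :: "'p \<Rightarrow> 'h \<Rightarrow> 'p"
  lact :: "'r \<Rightarrow> 'p \<Rightarrow> 'p"
  chi :: "'p \<Rightarrow> 'g \<Rightarrow> 'r"

text \<open>As for \<open>Aut(G)\<close>, smoothness of \<open>\<chi>\<close> as a map into the band is smoothness of the
  evaluation map \<open>(p, g) \<mapsto> \<chi>(p)(g)\<close>.\<close>

definition GH_extension ::
  "('g, 'eg::real_normed_vector) lie_grp \<Rightarrow> ('h, 'eh::real_normed_vector) lie_grp \<Rightarrow>
   ('g \<Rightarrow> 'h) \<Rightarrow> ('h \<Rightarrow> 'g \<Rightarrow> 'g) \<Rightarrow> ('s, 'es::real_normed_vector, 'm, 'em) groupoid \<Rightarrow>
   ('r, 'er::real_normed_vector, 'm, 'em::real_normed_vector, 's, 'g, 'h, 'p, 'ep::real_normed_vector) gh_ext \<Rightarrow>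
   bool" where
  "GH_extension G H \<rho> act S E \<longleftrightarrow>
     G_extension G (total E) S (eproj E) \<and>
     principal_bundle_over_groupoid H (total E) (ptot E) (bproj E) (ract E) (lact E) \<and>
     (\<forall>p\<in>pts (ptot E). chi E p \<in> band_fibre G (total E) S (eproj E) (bproj E p)) \<and>
     smooth_map (prod_mfd (ptot E) (gmfd G)) (arrows (total E)) (\<lambda>(p, g). chi E p g) \<and>
     (\<forall>x\<in>Arr (total E). \<forall>p\<in>pts (ptot E). \<forall>h\<in>carrier H. tgt (total E) x = bproj E p \<longrightarrow>
        chi E (ract E (lact E x p) h) =
          band_ract G (band_lact G (total E) x (chi E p)) (act h)) \<and>
     (\<forall>p\<in>pts (ptot E). \<forall>g\<in>carrier G. ract E p (\<rho> g) = lact E (chi E p g) p)"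

text \<open>Isomorphisms are taken extensional, so that the set below has no spurious elements
  differing only outside the carriers.\<close>

definition GH_isos ::
  "('g, 'eg::real_normed_vector) lie_grp \<Rightarrow> ('h, 'eh::real_normed_vector) lie_grp \<Rightarrow>
   ('r, 'er::real_normed_vector, 'm, 'em::real_normed_vector, 's, 'g, 'h, 'p, 'ep::real_normed_vector) gh_ext \<Rightarrow>
   ('r', 'er'::real_normed_vector, 'm, 'em, 's, 'g, 'h, 'p', 'ep'::real_normed_vector) gh_ext \<Rightarrow>
   (('r \<Rightarrow> 'r') \<times> ('p \<Rightarrow> 'p')) set" where
  "GH_isos G H E E' = {(\<Phi>, \<Psi>).
     \<Phi> \<in> extensional (Arr (total E)) \<and> \<Psi> \<in> extensional (pts (ptot E)) \<and>
     groupoid_morphism (total E) (total E') \<Phi> \<and>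
     diffeo (arrows (total E)) (arrows (total E')) \<Phi> \<and>
     (\<forall>x\<in>Arr (total E). eproj E' (\<Phi> x) = eproj E x) \<and>
     diffeo (ptot E) (ptot E') \<Psi> \<and>
     (\<forall>p\<in>pts (ptot E). bproj E' (\<Psi> p) = bproj E p) \<and>
     (\<forall>x\<in>Arr (total E). \<forall>p\<in>pts (ptot E). \<forall>h\<in>carrier H. tgt (total E) x = bproj E p \<longrightarrow>
        \<Psi> (ract E (lact E x p) h) = ract E' (lact E' (\<Phi> x) (\<Psi> p)) h) \<and>
     (\<forall>p\<in>pts (ptot E). chi E' (\<Psi> p) = (\<lambda>g\<in>carrier G. \<Phi> (chi E p g)))}"


section \<open>Adapted extensions, cocycles and coboundaries\<close>

type_synonym ('i, 'n, 'en, 'g, 'eg, 'h, 'eh) cech_ext =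
  "('g \<times> (('i \<times> 'i) \<times> 'n), 'eg \<times> 'en, 'i \<times> 'n, 'en, ('i \<times> 'i) \<times> 'n, 'g, 'h,
    ('i \<times> 'n) \<times> 'h, 'en \<times> 'eh) gh_ext"

definition adapted ::
  "('g, 'eg::real_normed_vector) lie_grp \<Rightarrow> ('h, 'eh::real_normed_vector) lie_grp \<Rightarrow>
   ('g \<Rightarrow> 'h) \<Rightarrow> ('h \<Rightarrow> 'g \<Rightarrow> 'g) \<Rightarrow> ('n, 'en::real_normed_vector) mfd \<Rightarrow> 'i set \<Rightarrow> ('i \<Rightarrow> 'n set) \<Rightarrow>
   ('i, 'n, 'en, 'g, 'eg, 'h, 'eh) cech_ext \<Rightarrow> bool" where
  "adapted G H \<rho> act N I U E \<longleftrightarrow>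
     GH_extension G H \<rho> act (cech N I U) E \<and>
     same_manifold (arrows (total E)) (prod_mfd (gmfd G) (cover2 N I U)) \<and>
     (\<forall>g\<in>carrier G. \<forall>a\<in>pts (cover2 N I U). eproj E (g, a) = a) \<and>
     same_manifold (ptot E) (prod_mfd (cover1 N I U) (gmfd H)) \<and>
     (\<forall>m\<in>pts (cover1 N I U). \<forall>h\<in>carrier H. bproj E (m, h) = m) \<and>
     (\<forall>m\<in>pts (cover1 N I U). \<forall>h\<in>carrier H. \<forall>h'\<in>carrier H.
        ract E (m, h) h' = (m, h \<otimes>\<^bsub>H\<^esub> h')) \<and>
     (\<forall>i\<in>I. \<forall>x\<in>U i. \<forall>h\<in>carrier H.
        chi E ((i, x), h) = (\<lambda>g\<in>carrier G. (act h g, ((i, i), x)))) \<and>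
     (\<forall>i\<in>I. \<forall>j\<in>I. \<forall>x\<in>U i \<inter> U j. \<forall>g\<in>carrier G. \<forall>g'\<in>carrier G.
        gprod (total E) (g, ((i, i), x)) (g', ((i, j), x)) = (g \<otimes>\<^bsub>G\<^esub> g', ((i, j), x)))"

definition cocycle ::
  "('g, 'eg::real_normed_vector) lie_grp \<Rightarrow> ('h, 'eh::real_normed_vector) lie_grp \<Rightarrow>
   ('g \<Rightarrow> 'h) \<Rightarrow> ('h \<Rightarrow> 'g \<Rightarrow> 'g) \<Rightarrow> ('n, 'en::real_normed_vector) mfd \<Rightarrow> 'i set \<Rightarrow> ('i \<Rightarrow> 'n set) \<Rightarrow>
   (('i \<times> 'i) \<times> 'n \<Rightarrow> 'h) \<Rightarrow> (('i \<times> 'i \<times> 'i) \<times> 'n \<Rightarrow> 'g) \<Rightarrow> bool" where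
  "cocycle G H \<rho> act N I U lam gg \<longleftrightarrow>
     lam \<in> C_inf (cover2 N I U) (gmfd H) \<and> gg \<in> C_inf (cover3 N I U) (gmfd G) \<and>
     (\<forall>i\<in>I. \<forall>j\<in>I. \<forall>k\<in>I. \<forall>x\<in>U i \<inter> U j \<inter> U k.
        \<rho> (gg ((i, j, k), x)) \<otimes>\<^bsub>H\<^esub> lam ((i, k), x) = lam ((i, j), x) \<otimes>\<^bsub>H\<^esub> lam ((j, k), x)) \<and>
     (\<forall>i\<in>I. \<forall>j\<in>I. \<forall>k\<in>I. \<forall>l\<in>I. \<forall>x\<in>U i \<inter> U j \<inter> U k \<inter> U l.
        gg ((i, j, k), x) \<otimes>\<^bsub>G\<^esub> gg ((i, k, l), x) =
        act (lam ((i, j), x)) (gg ((j, k, l), x)) \<otimes>\<^bsub>G\<^esub> gg ((i, j, l), x)) \<and>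
     (\<forall>i\<in>I. \<forall>j\<in>I. \<forall>x\<in>U i \<inter> U j. gg ((i, i, j), x) = \<one>\<^bsub>G\<^esub>)"

definition associated ::
  "('g, 'eg) lie_grp \<Rightarrow> ('h, 'eh) lie_grp \<Rightarrow> 'i set \<Rightarrow> ('i \<Rightarrow> 'n set) \<Rightarrow>
   ('i, 'n, 'en, 'g, 'eg, 'h, 'eh) cech_ext \<Rightarrow>
   (('i \<times> 'i) \<times> 'n \<Rightarrow> 'h) \<Rightarrow> (('i \<times> 'i \<times> 'i) \<times> 'n \<Rightarrow> 'g) \<Rightarrow> bool" where
  "associated G H I U E lam gg \<longleftrightarrow>
     (\<forall>i\<in>I. \<forall>j\<in>I. \<forall>x\<in>U i \<inter> U j.
        lact E (\<one>\<^bsub>G\<^esub>, ((i, j), x)) ((j, x), \<one>\<^bsub>H\<^esub>) = ((i, x), lam ((i, j), x))) \<and>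
     (\<forall>i\<in>I. \<forall>j\<in>I. \<forall>k\<in>I. \<forall>x\<in>U i \<inter> U j \<inter> U k.
        gprod (total E) (\<one>\<^bsub>G\<^esub>, ((i, j), x)) (\<one>\<^bsub>G\<^esub>, ((j, k), x)) = (gg ((i, j, k), x), ((i, k), x)))"

definition coboundaries ::
  "('g, 'eg::real_normed_vector) lie_grp \<Rightarrow> ('h, 'eh::real_normed_vector) lie_grp \<Rightarrow>
   ('n, 'en::real_normed_vector) mfd \<Rightarrow> 'i set \<Rightarrow> ('i \<Rightarrow> 'n set) \<Rightarrow>
   (('i \<times> 'n \<Rightarrow> 'h) \<times> (('i \<times> 'i) \<times> 'n \<Rightarrow> 'g)) set" where
  "coboundaries G H N I U = C_inf (cover1 N I U) (gmfd H) \<times> C_inf (cover2 N I U) (gmfd G)"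

definition coboundaries_relating ::
  "('g, 'eg::real_normed_vector) lie_grp \<Rightarrow> ('h, 'eh::real_normed_vector) lie_grp \<Rightarrow>
   ('g \<Rightarrow> 'h) \<Rightarrow> ('h \<Rightarrow> 'g \<Rightarrow> 'g) \<Rightarrow> ('n, 'en::real_normed_vector) mfd \<Rightarrow> 'i set \<Rightarrow> ('i \<Rightarrow> 'n set) \<Rightarrow>
   (('i \<times> 'i) \<times> 'n \<Rightarrow> 'h) \<Rightarrow> (('i \<times> 'i \<times> 'i) \<times> 'n \<Rightarrow> 'g) \<Rightarrow>
   (('i \<times> 'i) \<times> 'n \<Rightarrow> 'h) \<Rightarrow> (('i \<times> 'i \<times> 'i) \<times> 'n \<Rightarrow> 'g) \<Rightarrow>
   (('i \<times> 'n \<Rightarrow> 'h) \<times> (('i \<times> 'i) \<times> 'n \<Rightarrow> 'g)) set" where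
  "coboundaries_relating G H \<rho> act N I U lam gg lam' gg' =
     {(r, v) \<in> coboundaries G H N I U.
       (\<forall>i\<in>I. \<forall>j\<in>I. \<forall>x\<in>U i \<inter> U j.
          lam' ((i, j), x) =
          \<rho> (v ((i, j), x)) \<otimes>\<^bsub>H\<^esub> r (i, x) \<otimes>\<^bsub>H\<^esub> lam ((i, j), x) \<otimes>\<^bsub>H\<^esub> inv\<^bsub>H\<^esub> (r (j, x))) \<and>
       (\<forall>i\<in>I. \<forall>j\<in>I. \<forall>k\<in>I. \<forall>x\<in>U i \<inter> U j \<inter> U k.
          gg' ((i, j, k), x) \<otimes>\<^bsub>G\<^esub> v ((i, k), x) =
          act (lam' ((i, j), x)) (v ((j, k), x)) \<otimes>\<^bsub>G\<^esub> v ((i, j), x) \<otimes>\<^bsub>G\<^esub>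
            act (r (i, x)) (gg ((i, j, k), x)))}"

definition coboundary_of_iso ::
  "('g, 'eg) lie_grp \<Rightarrow> ('h, 'eh) lie_grp \<Rightarrow> ('n, 'en) mfd \<Rightarrow> 'i set \<Rightarrow> ('i \<Rightarrow> 'n set) \<Rightarrow>
   ('g \<times> (('i \<times> 'i) \<times> 'n) \<Rightarrow> 'g \<times> (('i \<times> 'i) \<times> 'n)) \<times> (('i \<times> 'n) \<times> 'h \<Rightarrow> ('i \<times> 'n) \<times> 'h) \<Rightarrow>
   ('i \<times> 'n \<Rightarrow> 'h) \<times> (('i \<times> 'i) \<times> 'n \<Rightarrow> 'g)" where
  "coboundary_of_iso G H N I U = (\<lambda>(\<Phi>, \<Psi>).
     (\<lambda>m\<in>pts (cover1 N I U). snd (\<Psi> (m, \<one>\<^bsub>H\<^esub>)),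
      \<lambda>a\<in>pts (cover2 N I U). inv\<^bsub>G\<^esub> (fst (\<Phi> (\<one>\<^bsub>G\<^esub>, a)))))"

definition iso_of_coboundary ::
  "('g, 'eg) lie_grp \<Rightarrow> ('h, 'eh) lie_grp \<Rightarrow> ('h \<Rightarrow> 'g \<Rightarrow> 'g) \<Rightarrow>
   ('n, 'en) mfd \<Rightarrow> 'i set \<Rightarrow> ('i \<Rightarrow> 'n set) \<Rightarrow>
   ('i \<times> 'n \<Rightarrow> 'h) \<times> (('i \<times> 'i) \<times> 'n \<Rightarrow> 'g) \<Rightarrow>
   ('g \<times> (('i \<times> 'i) \<times> 'n) \<Rightarrow> 'g \<times> (('i \<times> 'i) \<times> 'n)) \<times> (('i \<times> 'n) \<times> 'h \<Rightarrow> ('i \<times> 'n) \<times> 'h)" where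
  "iso_of_coboundary G H act N I U = (\<lambda>(r, v).
     (\<lambda>(g, ((i, j), x))\<in>carrier G \<times> pts (cover2 N I U).
        (act (r (i, x)) g \<otimes>\<^bsub>G\<^esub> inv\<^bsub>G\<^esub> (v ((i, j), x)), ((i, j), x)),
      \<lambda>((i, x), h)\<in>pts (cover1 N I U) \<times> carrier H. ((i, x), r (i, x) \<otimes>\<^bsub>H\<^esub> h)))"

end

theory Submission
  imports Defs
begin

text \<open>
  In an adapted extension every arrow factors as \<open>(g, x\<^sub>i\<^sub>j) = (g, x\<^sub>i\<^sub>i)(e, x\<^sub>i\<^sub>j)\<close>, and the
  conditions on \<open>\<chi>\<close> determine how \<open>(e, x\<^sub>i\<^sub>j)\<close> moves past the kernel and how the kernel acts on
  \<open>P\<close>; so product and action are given by the cocycle. An isomorphism is equivariant and compatible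
  with \<open>\<chi>\<close>, hence determined by its values \<open>(x\<^sub>i, r\<^sub>i)\<close> at \<open>(x\<^sub>i, e)\<close> and
  \<open>(v\<^sub>i\<^sub>j\<inverse>, x\<^sub>i\<^sub>j)\<close> at \<open>(e, x\<^sub>i\<^sub>j)\<close>. Equivariance evaluated at \<open>(e, x\<^sub>i\<^sub>j)\<close>, \<open>(x\<^sub>j, e)\<close> is the first
  coboundary relation, and multiplicativity evaluated at \<open>(e, x\<^sub>i\<^sub>j)\<close>, \<open>(e, x\<^sub>j\<^sub>k)\<close> the second.
  Smoothness transfers because all maps involved are built from \<open>r\<close>, \<open>v\<close> and the smooth
  operations of the crossed module.
\<close>

section \<open>Calculus of \<open>C\<^sup>k\<close> maps\<close>

text \<open>Two things shape the proof. First, adaptedness prescribes the point sets, products with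
  a kernel arrow on the left, and smooth structures only up to equivalent atlases. Units, sources
  and targets must be deduced from the projection being a morphism, and smoothness is carried to the
  product atlases by composing with identity maps. Second, a coboundary is not assumed normalized.
  Its second relation at equal indices \<open>i\<close>, \<open>i\<close>, \<open>i\<close> forces
  \<open>v ((i, i), x)\<close> to be neutral; without this the map built from (r, v) would respect
  neither units nor \<open>chi\<close>. For general arrows the first relation together with the
  identity for \<open>act (\<rho> g)\<close> turns the action of \<open>lam'\<close> into a
  conjugation by \<open>v\<close>, and these conjugations telescope. The analysis is done in charts.
  \<open>Ck_on\<close> iterates derivatives in fixed directions, whereas the chain rule
  differentiates in a moving direction; expanding that direction in coordinates repairs this, and it
  is the only place where finite dimension of the model space enters the calculus.\<close>

lemma Ck_on_cong:
  assumes "open S" "\<And>x. x \<in> S \<Longrightarrow> f x = g x" "Ck_on k S f"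
  shows "Ck_on k S g"
  using assms(2,3)
proof (induction k arbitrary: f g)
  case 0
  then show ?case using continuous_on_eq by auto
next
  case (Suc k)
  have d: "(g has_derivative frechet_derivative f (at x)) (at x)" if "x \<in> S" for x
  proof (rule has_derivative_transform_within_open[OF _ \<open>open S\<close> that])
    show "(f has_derivative frechet_derivative f (at x)) (at x)"
      using Suc.prems(2) that by (simp add: frechet_derivative_works)
  qed (rule Suc.prems(1))
  then have "frechet_derivative g (at x) = frechet_derivative f (at x)" if "x \<in> S" for x
    using frechet_derivative_at that by metis
  moreover have "Ck_on k S (\<lambda>x. frechet_derivative f (at x) v)" for v
    using Suc.prems by simp
  ultimately have "Ck_on k S (\<lambda>x. frechet_derivative g (at x) v)" for v
    using Suc.IH[of "\<lambda>x. frechet_derivative f (at x) v" "\<lambda>x. frechet_derivative g (at x) v"] by simp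
  with d show ?case by (auto simp: differentiable_def)
qed

text \<open>\<open>frechet_derivative\<close> is a choice operator. This rule lets any explicit
  derivative formula stand in for it, which is legitimate because derivatives at a point are unique
  and \<open>S\<close> is open.\<close>

lemma Ck_on_SucI:
  assumes "open S" "\<And>x. x \<in> S \<Longrightarrow> (f has_derivative f' x) (at x)" "\<And>v. Ck_on k S (\<lambda>x. f' x v)"
  shows "Ck_on (Suc k) S f"
proof -
  have "f' x v = frechet_derivative f (at x) v" if "x \<in> S" for x v
    using assms(2)[OF that] frechet_derivative_at by metis
  then have "Ck_on k S (\<lambda>x. frechet_derivative f (at x) v)" for v
    using assms(3) by (rule Ck_on_cong[OF assms(1)])
  with assms(2) show ?thesis by (auto simp: differentiable_def)
qed

lemma Ck_on_SucE:
  assumes "Ck_on (Suc k) S f" "x \<in> S"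
  shows "(f has_derivative frechet_derivative f (at x)) (at x)"
  using assms by (simp add: frechet_derivative_works)

text \<open>The successor clause of \<open>Ck_on\<close> mentions differentiability but not the
  lower order itself. At order 0 differentiability gives continuity; above that the induction passes
  to directional derivatives.\<close>

lemma Ck_on_SucD: "Ck_on (Suc k) S f \<Longrightarrow> Ck_on k S f"
proof (induction k arbitrary: f)
  case 0
  then show ?case
    by (auto intro: differentiable_imp_continuous_on
        simp: differentiable_on_def differentiable_at_withinI)
next
  case (Suc k)
  have "Ck_on k S (\<lambda>x. frechet_derivative f (at x) v)" for v
    using Suc.prems by (intro Suc.IH) simp
  with Suc.prems show ?case by simp
qed

lemma Ck_on_subset: "Ck_on k S f \<Longrightarrow> T \<subseteq> S \<Longrightarrow> Ck_on k T f"
  by (induction k arbitrary: f) (auto intro: continuous_on_subset)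

text \<open>Needed for compositions of maps of manifolds, where the intermediate chart changes from
  point to point.\<close>

lemma Ck_on_local:
  assumes "\<And>x. x \<in> S \<Longrightarrow> \<exists>T. open T \<and> x \<in> T \<and> Ck_on k T f"
  shows "Ck_on k S f"
  using assms
proof (induction k arbitrary: f)
  case 0
  have "isCont f x" if "x \<in> S" for x
    using "0"[OF that] by (auto simp: continuous_on_eq_continuous_at)
  then show ?case by (simp add: continuous_at_imp_continuous_on)
next
  case (Suc k)
  have "Ck_on k S (\<lambda>x. frechet_derivative f (at x) v)" for v
  proof (rule Suc.IH)
    show "\<exists>T. open T \<and> x \<in> T \<and> Ck_on k T (\<lambda>x. frechet_derivative f (at x) v)" if "x \<in> S" for x
      using Suc.prems[OF that] by auto
  qed
  moreover have "f differentiable (at x)" if "x \<in> S" for x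
    using Suc.prems[OF that] by auto
  ultimately show ?case by simp
qed

lemma Ck_on_const: "Ck_on k S (\<lambda>x. c)"
  by (induction k arbitrary: c) auto

lemma Ck_on_linear:
  assumes "bounded_linear L" "open S"
  shows "Ck_on k S L"
proof (cases k)
  case 0
  with assms show ?thesis by (simp add: linear_continuous_on)
next
  case (Suc l)
  show ?thesis
    unfolding Suc
    by (rule Ck_on_SucI[where f' = "\<lambda>_. L"])
      (simp_all add: assms bounded_linear_imp_has_derivative Ck_on_const)
qed

lemma Ck_on_linear_comp:
  assumes "bounded_linear L" "open S" "Ck_on k S f"
  shows "Ck_on k S (\<lambda>x. L (f x))"
  using assms(3)
proof (induction k arbitrary: f)
  case 0
  then show ?case by (simp add: bounded_linear.continuous_on[OF assms(1)])
next
  case (Suc k)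
  show ?case
  proof (rule Ck_on_SucI[OF \<open>open S\<close>])
    show "((\<lambda>x. L (f x)) has_derivative (\<lambda>v. L (frechet_derivative f (at x) v))) (at x)" if "x \<in> S" for x
      using Ck_on_SucE[OF Suc.prems that] by (rule bounded_linear.has_derivative[OF assms(1)])
  qed (use Suc in auto)
qed

lemma Ck_on_add:
  assumes "open S" "Ck_on k S f" "Ck_on k S g"
  shows "Ck_on k S (\<lambda>x. f x + g x)"
  using assms(2,3)
proof (induction k arbitrary: f g)
  case 0
  then show ?case by (simp add: continuous_on_add)
next
  case (Suc k)
  show ?case
  proof (rule Ck_on_SucI[OF \<open>open S\<close>])
    show "((\<lambda>x. f x + g x) has_derivative
        (\<lambda>v. frechet_derivative f (at x) v + frechet_derivative g (at x) v)) (at x)" if "x \<in> S" for x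
      using Suc.prems that by (intro has_derivative_add Ck_on_SucE)
  qed (use Suc in auto)
qed

lemma Ck_on_sum:
  assumes "open S" "\<And>i. i \<in> A \<Longrightarrow> Ck_on k S (f i)"
  shows "Ck_on k S (\<lambda>x. \<Sum>i\<in>A. f i x)"
  using assms(2)
  by (induction A rule: infinite_finite_induct) (auto intro: Ck_on_const Ck_on_add[OF assms(1)])

text \<open>The product rule also contains the undifferentiated factors, so the induction needs both
  functions at the lower order; \<open>low\<close> provides this.\<close>

lemma Ck_on_scaleR:
  fixes f :: "'a::real_normed_vector \<Rightarrow> real" and g :: "'a \<Rightarrow> 'b::real_normed_vector"
  assumes "open S" "Ck_on k S f" "Ck_on k S g"
  shows "Ck_on k S (\<lambda>x. f x *\<^sub>R g x)"
  using assms(2,3)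
proof (induction k arbitrary: f g)
  case 0
  then show ?case by (simp add: continuous_on_scaleR)
next
  case (Suc k)
  note low = Suc.prems[THEN Ck_on_SucD]
  show ?case
  proof (rule Ck_on_SucI[OF \<open>open S\<close>])
    show "((\<lambda>x. f x *\<^sub>R g x) has_derivative
        (\<lambda>v. f x *\<^sub>R frechet_derivative g (at x) v + frechet_derivative f (at x) v *\<^sub>R g x)) (at x)"
      if "x \<in> S" for x
      using Suc.prems that by (intro has_derivative_scaleR Ck_on_SucE)
    show "Ck_on k S (\<lambda>x. f x *\<^sub>R frechet_derivative g (at x) v + frechet_derivative f (at x) v *\<^sub>R g x)" for v
      using Suc.prems low by (intro Ck_on_add[OF \<open>open S\<close>] Suc.IH) auto
  qed
qed

lemma Ck_on_Pair:
  assumes "open S" "Ck_on k S f" "Ck_on k S g"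
  shows "Ck_on k S (\<lambda>x. (f x, g x))"
  using assms(2,3)
proof (induction k arbitrary: f g)
  case 0
  then show ?case by (simp add: continuous_on_Pair)
next
  case (Suc k)
  show ?case
  proof (rule Ck_on_SucI[OF \<open>open S\<close>])
    show "((\<lambda>x. (f x, g x)) has_derivative
        (\<lambda>v. (frechet_derivative f (at x) v, frechet_derivative g (at x) v))) (at x)" if "x \<in> S" for x
      using Suc.prems that by (intro has_derivative_Pair Ck_on_SucE)
  qed (use Suc in auto)
qed

text \<open>The model spaces carry no completeness class, so that coordinates are continuous has to be
  proved from scratch: a finite-dimensional subspace is complete, hence closed, and a vector
  outside it has positive distance from it.\<close>

lemma finite_independent_norm_bound:
  fixes B :: "'a::real_normed_vector set"
  assumes "finite B" "independent B"
  shows "\<exists>C>0. \<forall>c. \<forall>b\<in>B. \<bar>c b\<bar> \<le> C * norm (\<Sum>b\<in>B. c b *\<^sub>R b)"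
  using assms
proof (induction B rule: finite_induct)
  case empty
  show ?case by (intro exI[of _ 1]) simp
next
  case (insert a B)
  from insert obtain C where C: "C > 0" "\<And>c b. b \<in> B \<Longrightarrow> \<bar>c b\<bar> \<le> C * norm (\<Sum>b\<in>B. c b *\<^sub>R b)"
    by (auto simp: independent_insert)
  have aB: "a \<notin> span B" using insert by (auto simp: independent_insert)
  have "closed (span B)"
    unfolding closed_sequential_limits
  proof (intro allI impI, elim conjE)
    fix s l assume s: "\<forall>n. s n \<in> span B" "s \<longlonglongrightarrow> l"
    from s(1) have "\<forall>n. \<exists>c. s n = (\<Sum>b\<in>B. c b *\<^sub>R b)"
      by (auto simp: span_finite[OF \<open>finite B\<close>])
    then obtain c where c: "\<And>n. s n = (\<Sum>b\<in>B. c n b *\<^sub>R b)" by metis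
    have "convergent (\<lambda>n. c n b)" if b: "b \<in> B" for b
    proof -
      have "Cauchy s" using s(2) LIMSEQ_imp_Cauchy by blast
      \<comment> \<open>The induction hypothesis is applied to differences of coefficients, so
        coordinates of a Cauchy sequence are Cauchy. Only completeness of the reals is used.\<close>
      have "Cauchy (\<lambda>n. c n b)"
      proof (rule metric_CauchyI)
        fix e :: real assume "e > 0"
        then have "e / C > 0" using C by simp
        then obtain M where M: "\<And>m n. m \<ge> M \<Longrightarrow> n \<ge> M \<Longrightarrow> dist (s m) (s n) < e / C"
          using \<open>Cauchy s\<close> by (meson metric_CauchyD)
        have "dist (c m b) (c n b) < e" if "m \<ge> M" "n \<ge> M" for m n
        proof -
          have "dist (c m b) (c n b) \<le> C * norm (s m - s n)"
            using C(2)[OF b, of "\<lambda>b. c m b - c n b"]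
            by (simp add: c dist_real_def scaleR_left_diff_distrib sum_subtractf)
          also have "\<dots> < e"
            using M[OF that] C by (simp add: dist_norm pos_less_divide_eq mult.commute)
          finally show ?thesis .
        qed
        then show "\<exists>M. \<forall>m\<ge>M. \<forall>n\<ge>M. dist (c m b) (c n b) < e" by blast
      qed
      then show ?thesis by (simp add: Cauchy_convergent)
    qed
    then obtain d where "\<And>b. b \<in> B \<Longrightarrow> (\<lambda>n. c n b) \<longlonglongrightarrow> d b"
      unfolding convergent_def by metis
    then have "s \<longlonglongrightarrow> (\<Sum>b\<in>B. d b *\<^sub>R b)"
      unfolding c by (intro tendsto_sum tendsto_scaleR) auto
    with s(2) have "l = (\<Sum>b\<in>B. d b *\<^sub>R b)" using LIMSEQ_unique by blast
    then show "l \<in> span B" by (simp add: span_sum span_scale span_base)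
  qed
  then have "infdist a (span B) > 0"
    using aB span_zero by (intro infdist_pos_not_in_closed) auto
  then obtain d where d: "d > 0" "\<And>y. y \<in> span B \<Longrightarrow> d \<le> dist a y"
    using infdist_le by metis
  \<comment> \<open>The first entry bounds the coefficient of \<open>a\<close>, since x / c(a)
    differs from \<open>a\<close> by an element of \<open>span B\<close>. The second bounds the
    others: they are at most C times the norm of y = x - c(a) a, and that norm is at most (1 + norm
    a / d) times the norm of x.\<close>
  define D where "D = max (1 / d) (C * (1 + norm a / d))"
  have "\<bar>c b\<bar> \<le> D * norm (\<Sum>b\<in>insert a B. c b *\<^sub>R b)" if b: "b \<in> insert a B" for c b
  proof -
    define x where "x = (\<Sum>b\<in>insert a B. c b *\<^sub>R b)"
    define y where "y = (\<Sum>b\<in>B. c b *\<^sub>R b)"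
    have x: "x = c a *\<^sub>R a + y" using insert by (simp add: x_def y_def)
    have y: "y \<in> span B" by (simp add: y_def span_sum span_scale span_base)
    have a: "\<bar>c a\<bar> \<le> norm x / d"
    proof (cases "c a = 0")
      case False
      have d': "d \<le> dist a (- (1 / c a) *\<^sub>R y)" using y by (intro d(2) span_scale)
      have "a - - (1 / c a) *\<^sub>R y = (1 / c a) *\<^sub>R x"
        using False unfolding x by (simp add: scaleR_add_right)
      then have D: "dist a (- (1 / c a) *\<^sub>R y) = norm x / \<bar>c a\<bar>"
        by (simp only: dist_norm norm_scaleR abs_divide abs_one times_divide_eq_left mult_1_left)
      have "d * \<bar>c a\<bar> \<le> norm x" using d' False unfolding D by (simp add: pos_le_divide_eq)
      then show ?thesis using d(1) by (simp add: pos_le_divide_eq mult.commute)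
    qed (use d in simp)
    have "norm y \<le> norm x + \<bar>c a\<bar> * norm a"
      using norm_triangle_ineq4[of x "c a *\<^sub>R a"] by (simp add: x)
    also have "\<dots> \<le> norm x + norm x / d * norm a"
      using mult_right_mono[OF a norm_ge_zero[of a]] by simp
    also have "\<dots> = (1 + norm a / d) * norm x" by (simp add: algebra_simps)
    finally have ny: "norm y \<le> (1 + norm a / d) * norm x" .
    have "\<bar>c b\<bar> \<le> D * norm x"
    proof (cases "b = a")
      case True
      then have "\<bar>c b\<bar> \<le> 1 / d * norm x" using a by simp
      also have "\<dots> \<le> D * norm x" unfolding D_def by (intro mult_right_mono) auto
      finally show ?thesis .
    next
      case False
      then have "\<bar>c b\<bar> \<le> C * norm y" using C(2) b by (simp add: y_def)
      also have "\<dots> \<le> C * ((1 + norm a / d) * norm x)" using ny C by simp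
      also have "\<dots> = C * (1 + norm a / d) * norm x" by simp
      also have "\<dots> \<le> D * norm x" unfolding D_def by (intro mult_right_mono) auto
      finally show ?thesis .
    qed
    then show ?thesis by (simp add: x_def)
  qed
  moreover have "D > 0" using d(1) unfolding D_def by (simp add: less_max_iff_disj)
  ultimately show ?case by blast
qed

text \<open>The witness is a maximal independent subset of the given spanning set, with
  \<open>representation\<close> as coordinates; the norm bound makes them bounded. Coordinates for
  vectors outside this subset vanish, so boundedness holds for every \<open>b\<close> without a
  membership condition.\<close>

lemma finite_dim_coordinates:
  assumes "finite (B::'a::real_normed_vector set)" "span B = UNIV"
  shows "\<exists>B (c :: 'a \<Rightarrow> 'a \<Rightarrow> real). finite B \<and> (\<forall>b. bounded_linear (c b)) \<and>
    (\<forall>x. x = (\<Sum>b\<in>B. c b x *\<^sub>R b))"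
proof -
  obtain B' where B': "B' \<subseteq> B" "independent B'" "B \<subseteq> span B'"
    using maximal_independent_subset by blast
  have fin: "finite B'" using B' assms finite_subset by blast
  have sp: "span B' = UNIV" using B'(3) assms(2) by (metis span_mono span_span top.extremum_unique)
  define c where "c = (\<lambda>b x. representation B' x b)"
  have x: "x = (\<Sum>b\<in>B'. c b x *\<^sub>R b)" for x
    unfolding c_def using B' fin sp by (subst real_vector.sum_representation_eq) auto
  obtain C where C: "\<And>c b. b \<in> B' \<Longrightarrow> \<bar>c b\<bar> \<le> C * norm (\<Sum>b\<in>B'. c b *\<^sub>R b)"
    using finite_independent_norm_bound[OF fin B'(2)] by blast
  have "bounded_linear (c b)" for b
  proof (rule bounded_linear_intro)
    show "norm (c b x) \<le> norm x * \<bar>C\<bar>" for x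
    proof (cases "b \<in> B'")
      case True
      then have "\<bar>c b x\<bar> \<le> C * norm x" using C[OF True, of "\<lambda>b. c b x"] by (simp only: x[symmetric])
      also have "\<dots> \<le> norm x * \<bar>C\<bar>" by (simp add: mult.commute mult_right_mono)
      finally show ?thesis by simp
    next
      case False
      then have "c b x = 0" unfolding c_def using real_vector.representation_ne_zero by blast
      then show ?thesis by simp
    qed
  qed (use B' sp in \<open>auto simp: c_def real_vector.representation_add real_vector.representation_scale\<close>)
  with fin x show ?thesis by blast
qed

text \<open>By the chain rule the derivative is that of \<open>g\<close> at \<open>f x\<close> in
  the direction \<open>?f' x v\<close>, which varies with \<open>x\<close>, while
  \<open>Ck_on\<close> controls only fixed directions. Writing the direction as a combination of the
  vectors in \<open>B\<close> leaves scalar coefficients times derivatives of \<open>g\<close> in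
  fixed directions composed with \<open>f\<close>. The latter fall under the induction hypothesis,
  which is why \<open>g\<close> is arbitrary in the induction.\<close>

lemma Ck_on_compose:
  fixes f :: "'a::real_normed_vector \<Rightarrow> 'b::real_normed_vector"
  assumes "\<exists>B::'b set. finite B \<and> span B = UNIV"
    and "open S" "open T" "f ` S \<subseteq> T" "Ck_on k S f" "Ck_on k T g"
  shows "Ck_on k S (\<lambda>x. g (f x))"
proof -
  obtain B and c :: "'b \<Rightarrow> 'b \<Rightarrow> real" where B: "finite B" "\<And>b. bounded_linear (c b)"
    and coord: "\<And>x. x = (\<Sum>b\<in>B. c b x *\<^sub>R b)"
    using assms(1) finite_dim_coordinates by metis
  show ?thesis
    using assms(5,6)
  proof (induction k arbitrary: g)
    case 0
    then show ?case using assms(4) by (auto intro: continuous_on_compose2)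
  next
    case (Suc k)
    let ?f' = "\<lambda>x. frechet_derivative f (at x)" and ?g' = "\<lambda>x. frechet_derivative g (at x)"
    have g': "?g' (f x) w = (\<Sum>b\<in>B. c b w *\<^sub>R ?g' (f x) b)" if "x \<in> S" for x w
    proof -
      have "linear (?g' (f x))"
        using Ck_on_SucE[OF Suc.prems(2)] assms(4) that has_derivative_linear by blast
      moreover have "?g' (f x) w = ?g' (f x) (\<Sum>b\<in>B. c b w *\<^sub>R b)"
        by (rule arg_cong[OF coord])
      ultimately show ?thesis by (simp add: linear_sum linear_scale)
    qed
    show ?case
    proof (rule Ck_on_SucI[OF \<open>open S\<close>])
      fix x assume x: "x \<in> S"
      with assms(4) have "f x \<in> T" by blast
      then have "((\<lambda>x. g (f x)) has_derivative (\<lambda>v. ?g' (f x) (?f' x v))) (at x)"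
        by (intro has_derivative_compose[OF Ck_on_SucE[OF Suc.prems(1) x]] Ck_on_SucE[OF Suc.prems(2)])
      moreover have "(\<lambda>v. ?g' (f x) (?f' x v)) = (\<lambda>v. \<Sum>b\<in>B. c b (?f' x v) *\<^sub>R ?g' (f x) b)"
        by (intro ext g' x)
      ultimately show "((\<lambda>x. g (f x)) has_derivative (\<lambda>v. \<Sum>b\<in>B. c b (?f' x v) *\<^sub>R ?g' (f x) b)) (at x)"
        by (simp only:)
    next
      fix v
      have "Ck_on k S (\<lambda>x. ?f' x v)" using Suc.prems by simp
      note f' = Ck_on_linear_comp[OF B(2) \<open>open S\<close> this]
      have "Ck_on k S (\<lambda>x. ?g' (f x) b)" for b
        using Suc.prems(2) by (intro Suc.IH[of "\<lambda>y. ?g' y b"] Ck_on_SucD[OF Suc.prems(1)]) simp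
      then show "Ck_on k S (\<lambda>x. \<Sum>b\<in>B. c b (?f' x v) *\<^sub>R ?g' (f x) b)"
        by (intro Ck_on_sum[OF \<open>open S\<close>] Ck_on_scaleR[OF \<open>open S\<close> f'])
    qed
  qed
qed

section \<open>Smooth maps\<close>

lemma manifold_finite_dim: "manifold (M :: ('a, 'e::real_normed_vector) mfd) \<Longrightarrow> \<exists>B::'e set. finite B \<and> span B = UNIV"
  by (simp add: manifold_def)

lemma manifold_chart:
  assumes "manifold M" "(U, \<phi>) \<in> atlas M"
  shows "openin (mtop M) U" "U \<subseteq> pts M" "open (\<phi> ` U)" "inj_on \<phi> U"
    "homeomorphic_map (subtopology (mtop M) U) (top_of_set (\<phi> ` U)) \<phi>"
proof -
  show U: "openin (mtop M) U" and "open (\<phi> ` U)"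
    and h: "homeomorphic_map (subtopology (mtop M) U) (top_of_set (\<phi> ` U)) \<phi>"
    using assms unfolding manifold_def by blast+
  from U show sub: "U \<subseteq> pts M" by (rule openin_subset)
  from h sub show "inj_on \<phi> U"
    by (simp add: homeomorphic_eq_everything_map Int_absorb1)
qed

lemma manifold_covered:
  assumes "manifold M" "p \<in> pts M"
  obtains U \<phi> where "(U, \<phi>) \<in> atlas M" "p \<in> U"
  using assms unfolding manifold_def by blast

text \<open>Supplies the open domains that the \<open>Ck_on\<close> calculus requires.\<close>

lemma open_chart_image:
  assumes "manifold M" "(U, \<phi>) \<in> atlas M" "openin (mtop M) W" "W \<subseteq> U"
  shows "open (\<phi> ` W)"
proof -
  note c = manifold_chart[OF assms(1,2)]
  have "openin (subtopology (mtop M) U) W"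
    using assms c by (simp add: openin_open_subtopology)
  then have "openin (top_of_set (\<phi> ` U)) (\<phi> ` W)"
    using homeomorphic_imp_open_map[OF c(5)] by (simp add: open_map_def)
  then show ?thesis using c(3) by (simp add: openin_open_eq)
qed

lemma smooth_map_continuous: "smooth_map M N f \<Longrightarrow> continuous_map (mtop M) (mtop N) f"
  by (simp add: smooth_map_def)

lemma smooth_map_in_pts: "smooth_map M N f \<Longrightarrow> x \<in> pts M \<Longrightarrow> f x \<in> pts N"
  using smooth_map_continuous continuous_map_image_subset_topspace by blast

lemma smooth_map_chart:
  "\<lbrakk>smooth_map M N f; (U, \<phi>) \<in> atlas M; (V, \<psi>) \<in> atlas N\<rbrakk> \<Longrightarrow>
    Ck_on k (\<phi> ` {x \<in> U. f x \<in> V}) (\<psi> \<circ> f \<circ> inv_into U \<phi>)"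
  unfolding smooth_map_def smooth_on_def by blast

lemma smooth_mapI:
  assumes "continuous_map (mtop M) (mtop N) f"
    and "\<And>U \<phi> V \<psi> k. \<lbrakk>(U, \<phi>) \<in> atlas M; (V, \<psi>) \<in> atlas N\<rbrakk> \<Longrightarrow>
      Ck_on k (\<phi> ` {x \<in> U. f x \<in> V}) (\<psi> \<circ> f \<circ> inv_into U \<phi>)"
  shows "smooth_map M N f"
  using assms unfolding smooth_map_def smooth_on_def by blast

lemma open_chart_preimage:
  assumes "manifold M" "manifold N" "continuous_map (mtop M) (mtop N) f"
    and "(U, \<phi>) \<in> atlas M" "(V, \<psi>) \<in> atlas N"
  shows "open (\<phi> ` {x \<in> U. f x \<in> V})"
  using manifold_chart(1)[OF assms(1,4)] manifold_chart(1)[OF assms(2,5)]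
  by (intro open_chart_image[OF assms(1,4)] openin_continuous_map_preimage_gen[OF assms(3)]) auto

text \<open>Chart domains lie inside \<open>pts M\<close>, so values elsewhere do not matter. This
  allows passing between formulas, restricted functions and \<open>inv_into\<close>.\<close>

lemma smooth_map_cong:
  assumes "manifold M" "manifold N" "smooth_map M N f" "\<And>x. x \<in> pts M \<Longrightarrow> f x = g x"
  shows "smooth_map M N g"
proof (rule smooth_mapI)
  show "continuous_map (mtop M) (mtop N) g"
    using smooth_map_continuous[OF assms(3)] assms(4) by (rule continuous_map_eq)
  fix U \<phi> V \<psi> k assume c: "(U, \<phi>) \<in> atlas M" "(V, \<psi>) \<in> atlas N"
  have eq: "f x = g x" if "x \<in> U" for x
    using assms(4) manifold_chart(2)[OF assms(1) c(1)] that by blast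
  have "Ck_on k (\<phi> ` {x \<in> U. f x \<in> V}) (\<psi> \<circ> g \<circ> inv_into U \<phi>)"
    using open_chart_preimage[OF assms(1,2) smooth_map_continuous[OF assms(3)] c] _
      smooth_map_chart[OF assms(3) c]
    by (rule Ck_on_cong) (auto simp: eq inv_into_into)
  moreover have "{x \<in> U. f x \<in> V} = {x \<in> U. g x \<in> V}" using eq by auto
  ultimately show "Ck_on k (\<phi> ` {x \<in> U. g x \<in> V}) (\<psi> \<circ> g \<circ> inv_into U \<phi>)" by simp
qed

lemma smooth_map_id:
  assumes "manifold M"
  shows "smooth_map M M (\<lambda>x. x)"
proof (rule smooth_mapI)
  fix U \<phi> V \<psi> k assume c: "(U, \<phi>) \<in> atlas M" "(V, \<psi>) \<in> atlas M"
  have "smooth_on (\<phi> ` (U \<inter> V)) (\<psi> \<circ> inv_into U \<phi>)"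
    using assms c unfolding manifold_def by blast
  then show "Ck_on k (\<phi> ` {x \<in> U. x \<in> V}) (\<psi> \<circ> (\<lambda>x. x) \<circ> inv_into U \<phi>)"
    by (simp add: smooth_on_def Int_def o_def)
qed simp

lemma smooth_map_const: "c \<in> pts N \<Longrightarrow> smooth_map M N (\<lambda>x. c)"
  by (rule smooth_mapI) (auto simp: o_def Ck_on_const)

text \<open>No single chart of \<open>M\<close> need contain the image of a chart of
  \<open>L\<close>. Near each point a chart around \<open>f x\<close> is cut down to
  \<open>?P\<close>, where \<open>g\<close> lands in the target chart, and then pulled back to
  \<open>?T\<close>; there the composite is a composition of coordinate maps.\<close>

lemma smooth_map_compose:
  assumes "manifold L" "manifold M" "manifold N" "smooth_map L M f" "smooth_map M N g"
  shows "smooth_map L N (\<lambda>x. g (f x))"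
proof (rule smooth_mapI)
  note cf = smooth_map_continuous[OF assms(4)] and cg = smooth_map_continuous[OF assms(5)]
  show "continuous_map (mtop L) (mtop N) (\<lambda>x. g (f x))"
    using continuous_map_compose[OF cf cg] by (simp add: o_def)
  fix U \<phi> W \<theta> k assume c: "(U, \<phi>) \<in> atlas L" "(W, \<theta>) \<in> atlas N"
  show "Ck_on k (\<phi> ` {x \<in> U. g (f x) \<in> W}) (\<theta> \<circ> (\<lambda>x. g (f x)) \<circ> inv_into U \<phi>)"
  proof (rule Ck_on_local)
    fix y assume "y \<in> \<phi> ` {x \<in> U. g (f x) \<in> W}"
    then obtain x where x: "x \<in> U" "g (f x) \<in> W" "y = \<phi> x" by blast
    have "f x \<in> pts M"
      using smooth_map_in_pts[OF assms(4)] x manifold_chart(2)[OF assms(1) c(1)] by blast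
    then obtain V \<psi> where V: "(V, \<psi>) \<in> atlas M" "f x \<in> V"
      using manifold_covered[OF assms(2)] by blast
    let ?P = "{z \<in> V. g z \<in> W}"
    let ?T = "\<phi> ` {x \<in> U. f x \<in> ?P}"
    have oP: "openin (mtop M) ?P"
      using manifold_chart(1)[OF assms(2) V(1)] manifold_chart(1)[OF assms(3) c(2)]
      by (rule openin_continuous_map_preimage_gen[OF cg])
    have oT: "open ?T"
      using openin_continuous_map_preimage_gen[OF cf _ oP] manifold_chart(1)[OF assms(1) c(1)]
      by (intro open_chart_image[OF assms(1) c(1)]) auto
    have oP': "open (\<psi> ` ?P)"
      using oP by (intro open_chart_image[OF assms(2) V(1)]) auto
    have "Ck_on k ?T (\<lambda>y. (\<theta> \<circ> g \<circ> inv_into V \<psi>) ((\<psi> \<circ> f \<circ> inv_into U \<phi>) y))"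
    proof (rule Ck_on_compose[OF manifold_finite_dim[OF assms(2)] oT oP'])
      show "(\<psi> \<circ> f \<circ> inv_into U \<phi>) ` ?T \<subseteq> \<psi> ` ?P"
        using manifold_chart(4)[OF assms(1) c(1)] by auto
      show "Ck_on k ?T (\<psi> \<circ> f \<circ> inv_into U \<phi>)"
        using smooth_map_chart[OF assms(4) c(1) V(1)] by (rule Ck_on_subset) auto
      show "Ck_on k (\<psi> ` ?P) (\<theta> \<circ> g \<circ> inv_into V \<psi>)"
        using smooth_map_chart[OF assms(5) V(1) c(2)] .
    qed
    then have "Ck_on k ?T (\<theta> \<circ> (\<lambda>x. g (f x)) \<circ> inv_into U \<phi>)"
      by (rule Ck_on_cong[OF oT, rotated])
        (auto simp: manifold_chart(4)[OF assms(1) c(1)] manifold_chart(4)[OF assms(2) V(1)])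
    with oT x V show "\<exists>T. open T \<and> y \<in> T \<and> Ck_on k T (\<theta> \<circ> (\<lambda>x. g (f x)) \<circ> inv_into U \<phi>)"
      by blast
  qed
qed

text \<open>\<open>diffeo\<close> speaks of \<open>inv_into\<close>. An explicit inverse agrees with
  it on \<open>pts N\<close>, which is enough for smoothness.\<close>

lemma diffeoI:
  assumes "manifold M" "manifold N" "smooth_map M N f" "smooth_map N M g"
    and "\<And>x. x \<in> pts M \<Longrightarrow> g (f x) = x" "\<And>y. y \<in> pts N \<Longrightarrow> f (g y) = y"
  shows "diffeo M N f"
proof -
  have bij: "bij_betw f (pts M) (pts N)"
    using assms(5,6) smooth_map_in_pts[OF assms(3)] smooth_map_in_pts[OF assms(4)]
    by (intro bij_betw_byWitness[where f' = g]) auto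
  have "inv_into (pts M) f y = g y" if "y \<in> pts N" for y
    using assms(6) that smooth_map_in_pts[OF assms(4)] bij_betw_imp_inj_on[OF bij]
    by (intro inv_into_f_eq)
  then have "smooth_map N M (inv_into (pts M) f)"
    by (intro smooth_map_cong[OF assms(2,1,4)]) simp
  with bij assms(3) show ?thesis by (simp add: diffeo_def)
qed

lemma same_manifold_sym: "same_manifold M N \<Longrightarrow> same_manifold N M"
  by (simp add: same_manifold_def)

text \<open>The atlases may differ, so \<open>f\<close> is composed on both sides with identities
  that are smooth between them.\<close>

lemma smooth_map_same_manifold:
  assumes "manifold M" "manifold M'" "manifold N" "manifold N'"
    and "same_manifold M M'" "same_manifold N N'" "smooth_map M N f"
  shows "smooth_map M' N' f"
proof -
  have M': "smooth_map M' M (\<lambda>x. x)" and N': "smooth_map N N' (\<lambda>x. x)"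
    using assms(5,6) by (simp_all add: same_manifold_def)
  have "smooth_map M' N f"
    by (rule smooth_map_compose[OF assms(2,1,3) M' assms(7)])
  then show ?thesis
    by (rule smooth_map_compose[OF assms(2,3,4) _ N'])
qed

subsection \<open>Products\<close>

lemma pts_prod_mfd [simp]: "pts (prod_mfd M N) = pts M \<times> pts N"
  by (simp add: prod_mfd_def)

lemma mtop_prod_mfd: "mtop (prod_mfd M N) = prod_topology (mtop M) (mtop N)"
  by (simp add: prod_mfd_def)

lemma atlas_prod_mfdE:
  assumes "(W, \<theta>) \<in> atlas (prod_mfd M N)"
  obtains U \<phi> V \<psi> where "(U, \<phi>) \<in> atlas M" "(V, \<psi>) \<in> atlas N" "W = U \<times> V" "\<theta> = map_prod \<phi> \<psi>"
  using assms by (auto simp: prod_mfd_def)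

lemma atlas_prod_mfdI:
  "(U, \<phi>) \<in> atlas M \<Longrightarrow> (V, \<psi>) \<in> atlas N \<Longrightarrow> (U \<times> V, map_prod \<phi> \<psi>) \<in> atlas (prod_mfd M N)"
  by (auto simp: prod_mfd_def)

lemma inv_into_map_prod:
  assumes "inj_on f A" "inj_on g B" "x \<in> f ` A" "y \<in> g ` B"
  shows "inv_into (A \<times> B) (map_prod f g) (x, y) = (inv_into A f x, inv_into B g y)"
  using assms by (intro inv_into_f_eq map_prod_inj_on) (auto simp: inv_into_into f_inv_into_f)

lemma map_prod_Times: "map_prod f g ` (A \<times> B) = f ` A \<times> g ` B"
  by auto

lemma finite_dim_prod:
  assumes "\<exists>B::'d::real_normed_vector set. finite B \<and> span B = UNIV"
    and "\<exists>B::'e::real_normed_vector set. finite B \<and> span B = UNIV"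
  shows "\<exists>B::('d \<times> 'e) set. finite B \<and> span B = UNIV"
proof -
  obtain B :: "'d set" and C :: "'e set"
    where B: "finite B" "span B = UNIV" and C: "finite C" "span C = UNIV"
    using assms by auto
  let ?B = "(\<lambda>x::'d. (x, 0::'e)) ` B" and ?C = "(\<lambda>y::'e. (0::'d, y)) ` C"
  have l: "linear (\<lambda>x::'d. (x, 0::'e))" "linear (\<lambda>y::'e. (0::'d, y))"
    by (auto intro!: linearI)
  have "(x, y) \<in> span (?B \<union> ?C)" for x y
  proof -
    have "(x, 0) \<in> span ?B" "(0, y) \<in> span ?C"
      using linear_span_image[OF l(1), of B] linear_span_image[OF l(2), of C] B C by auto
    then have "(x, 0) \<in> span (?B \<union> ?C)" "(0, y) \<in> span (?B \<union> ?C)"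
      using span_mono[of ?B "?B \<union> ?C"] span_mono[of ?C "?B \<union> ?C"] by auto
    from span_add[OF this] show ?thesis by simp
  qed
  then have "span (?B \<union> ?C) = UNIV" by auto
  then show ?thesis using B(1) C(1) by (intro exI[of _ "?B \<union> ?C"]) simp
qed

lemma homeomorphic_map_prod:
  assumes "homeomorphic_map X X' f" "homeomorphic_map Y Y' g"
  shows "homeomorphic_map (prod_topology X Y) (prod_topology X' Y') (map_prod f g)"
proof -
  obtain f' g' where "homeomorphic_maps X X' f f'" "homeomorphic_maps Y Y' g g'"
    using assms unfolding homeomorphic_map_maps by blast
  then have "homeomorphic_maps (prod_topology X Y) (prod_topology X' Y')
      (\<lambda>(x, y). (f x, g y)) (\<lambda>(x, y). (f' x, g' y))"
    by (simp add: homeomorphic_maps_prod)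
  then show ?thesis
    unfolding homeomorphic_map_maps map_prod_def by blast
qed

lemma manifold_prod:
  fixes M :: "('a, 'd::real_normed_vector) mfd" and N :: "('b, 'e::real_normed_vector) mfd"
  assumes M: "manifold M" and N: "manifold N"
  shows "manifold (prod_mfd M N)"
  unfolding manifold_def
proof (intro conjI)
  show "\<exists>B::('d \<times> 'e) set. finite B \<and> span B = UNIV"
    by (intro finite_dim_prod manifold_finite_dim[OF M] manifold_finite_dim[OF N])
  show "Hausdorff_space (mtop (prod_mfd M N))"
    using M N by (simp add: mtop_prod_mfd Hausdorff_space_prod_topology manifold_def)
  show "pts (prod_mfd M N) = (\<Union>(W, \<theta>)\<in>atlas (prod_mfd M N). W)"
  proof
    show "pts (prod_mfd M N) \<subseteq> (\<Union>(W, \<theta>)\<in>atlas (prod_mfd M N). W)"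
    proof
      fix p assume "p \<in> pts (prod_mfd M N)"
      then have "fst p \<in> pts M" "snd p \<in> pts N" by auto
      obtain U \<phi> where "(U, \<phi>) \<in> atlas M" "fst p \<in> U"
        using manifold_covered[OF M \<open>fst p \<in> pts M\<close>] .
      moreover obtain V \<psi> where "(V, \<psi>) \<in> atlas N" "snd p \<in> V"
        using manifold_covered[OF N \<open>snd p \<in> pts N\<close>] .
      ultimately show "p \<in> (\<Union>(W, \<theta>)\<in>atlas (prod_mfd M N). W)"
        by (intro UN_I[OF atlas_prod_mfdI[of U \<phi> M V \<psi> N]]) (auto simp: mem_Times_iff)
    qed
    show "(\<Union>(W, \<theta>)\<in>atlas (prod_mfd M N). W) \<subseteq> pts (prod_mfd M N)"
      using manifold_chart(2)[OF M] manifold_chart(2)[OF N] by (fastforce elim: atlas_prod_mfdE)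
  qed
  show "\<forall>(W, \<theta>)\<in>atlas (prod_mfd M N). openin (mtop (prod_mfd M N)) W \<and> open (\<theta> ` W) \<and>
      homeomorphic_map (subtopology (mtop (prod_mfd M N)) W) (top_of_set (\<theta> ` W)) \<theta>"
  proof (intro ballI, clarify elim!: atlas_prod_mfdE)
    fix U \<phi> V \<psi> assume c: "(U, \<phi>) \<in> atlas M" "(V, \<psi>) \<in> atlas N"
    note m = manifold_chart[OF M c(1)] and n = manifold_chart[OF N c(2)]
    have "top_of_set (\<phi> ` U \<times> \<psi> ` V) = prod_topology (top_of_set (\<phi> ` U)) (top_of_set (\<psi> ` V))"
      by (simp only: prod_topology_euclidean[symmetric] subtopology_Times)
    then have "homeomorphic_map (subtopology (mtop (prod_mfd M N)) (U \<times> V))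
        (top_of_set (\<phi> ` U \<times> \<psi> ` V)) (map_prod \<phi> \<psi>)"
      using homeomorphic_map_prod[OF m(5) n(5)] by (simp only: mtop_prod_mfd subtopology_Times)
    then show "openin (mtop (prod_mfd M N)) (U \<times> V) \<and> open (map_prod \<phi> \<psi> ` (U \<times> V)) \<and>
      homeomorphic_map (subtopology (mtop (prod_mfd M N)) (U \<times> V))
        (top_of_set (map_prod \<phi> \<psi> ` (U \<times> V))) (map_prod \<phi> \<psi>)"
      using m(1,3) n(1,3)
      by (simp add: mtop_prod_mfd openin_prod_Times_iff map_prod_Times open_Times)
  qed
  show "\<forall>(W, \<theta>)\<in>atlas (prod_mfd M N). \<forall>(W', \<theta>')\<in>atlas (prod_mfd M N).
      smooth_on (\<theta> ` (W \<inter> W')) (\<theta>' \<circ> inv_into W \<theta>)"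
  proof (intro ballI, clarify elim!: atlas_prod_mfdE)
    fix U \<phi> V \<psi> U' \<phi>' V' \<psi>'
    assume c: "(U, \<phi>) \<in> atlas M" "(V, \<psi>) \<in> atlas N" "(U', \<phi>') \<in> atlas M" "(V', \<psi>') \<in> atlas N"
    let ?A = "\<phi> ` (U \<inter> U')" and ?B = "\<psi> ` (V \<inter> V')"
    have o: "open ?A" "open ?B"
      using c manifold_chart(1)[OF M] manifold_chart(1)[OF N]
      by (auto intro!: open_chart_image[OF M c(1)] open_chart_image[OF N c(2)])
    have im: "map_prod \<phi> \<psi> ` (U \<times> V \<inter> U' \<times> V') = ?A \<times> ?B" by auto
    show "smooth_on (map_prod \<phi> \<psi> ` (U \<times> V \<inter> U' \<times> V')) (map_prod \<phi>' \<psi>' \<circ> inv_into (U \<times> V) (map_prod \<phi> \<psi>))"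
      unfolding im smooth_on_def
    proof
      fix k
      \<comment> \<open>The factors' transition maps are coordinate forms of the identity. The
        product transition map pairs them after the two linear projections.\<close>
      have "Ck_on k ?A (\<phi>' \<circ> inv_into U \<phi>)" "Ck_on k ?B (\<psi>' \<circ> inv_into V \<psi>)"
        using smooth_map_chart[OF smooth_map_id[OF M] c(1,3)] smooth_map_chart[OF smooth_map_id[OF N] c(2,4)]
        by (simp_all add: Int_def o_def)
      then have "Ck_on k (?A \<times> ?B) (\<lambda>z. ((\<phi>' \<circ> inv_into U \<phi>) (fst z), (\<psi>' \<circ> inv_into V \<psi>) (snd z)))"
        by (intro Ck_on_Pair
            Ck_on_compose[OF manifold_finite_dim[OF M] _ o(1) _ Ck_on_linear[OF bounded_linear_fst]]
            Ck_on_compose[OF manifold_finite_dim[OF N] _ o(2) _ Ck_on_linear[OF bounded_linear_snd]])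
          (auto simp: o_def open_Times o)
      then show "Ck_on k (?A \<times> ?B) (map_prod \<phi>' \<psi>' \<circ> inv_into (U \<times> V) (map_prod \<phi> \<psi>))"
        by (rule Ck_on_cong[OF open_Times[OF o], rotated])
          (auto simp: inv_into_map_prod manifold_chart(4)[OF M c(1)] manifold_chart(4)[OF N c(2)])
    qed
  qed
qed

lemma smooth_map_fst:
  assumes M: "manifold M" and N: "manifold N"
  shows "smooth_map (prod_mfd M N) M fst"
proof (rule smooth_mapI)
  show "continuous_map (mtop (prod_mfd M N)) (mtop M) fst"
    by (simp add: mtop_prod_mfd continuous_map_fst)
  fix W \<theta> U' \<phi>' k assume "(W, \<theta>) \<in> atlas (prod_mfd M N)" and c': "(U', \<phi>') \<in> atlas M"
  then obtain U \<phi> V \<psi> where c: "(U, \<phi>) \<in> atlas M" "(V, \<psi>) \<in> atlas N"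
    and W: "W = U \<times> V" "\<theta> = map_prod \<phi> \<psi>" by (auto elim: atlas_prod_mfdE)
  let ?A = "\<phi> ` {x \<in> U. x \<in> U'}"
  have A: "open ?A" using open_chart_preimage[OF M M _ c(1) c'] by simp
  have V: "open (\<psi> ` V)" using manifold_chart[OF N c(2)] by simp
  have im: "\<theta> ` {z \<in> W. fst z \<in> U'} = ?A \<times> \<psi> ` V" unfolding W by force
  have "Ck_on k (?A \<times> \<psi> ` V) (\<lambda>z. (\<phi>' \<circ> (\<lambda>x. x) \<circ> inv_into U \<phi>) (fst z))"
    using smooth_map_chart[OF smooth_map_id[OF M] c(1) c']
    by (intro Ck_on_compose[OF manifold_finite_dim[OF M] _ A _ Ck_on_linear[OF bounded_linear_fst]])
      (auto simp: o_def open_Times A V)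
  then show "Ck_on k (\<theta> ` {z \<in> W. fst z \<in> U'}) (\<phi>' \<circ> fst \<circ> inv_into W \<theta>)"
    unfolding im
    by (rule Ck_on_cong[OF open_Times[OF A V], rotated])
      (auto simp: W inv_into_map_prod manifold_chart(4)[OF M c(1)] manifold_chart(4)[OF N c(2)])
qed

lemma smooth_map_snd:
  assumes M: "manifold M" and N: "manifold N"
  shows "smooth_map (prod_mfd M N) N snd"
proof (rule smooth_mapI)
  show "continuous_map (mtop (prod_mfd M N)) (mtop N) snd"
    by (simp add: mtop_prod_mfd continuous_map_snd)
  fix W \<theta> V' \<psi>' k assume "(W, \<theta>) \<in> atlas (prod_mfd M N)" and c': "(V', \<psi>') \<in> atlas N"
  then obtain U \<phi> V \<psi> where c: "(U, \<phi>) \<in> atlas M" "(V, \<psi>) \<in> atlas N"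
    and W: "W = U \<times> V" "\<theta> = map_prod \<phi> \<psi>" by (auto elim: atlas_prod_mfdE)
  let ?B = "\<psi> ` {y \<in> V. y \<in> V'}"
  have B: "open ?B" using open_chart_preimage[OF N N _ c(2) c'] by simp
  have U: "open (\<phi> ` U)" using manifold_chart[OF M c(1)] by simp
  have im: "\<theta> ` {z \<in> W. snd z \<in> V'} = \<phi> ` U \<times> ?B" unfolding W by force
  have "Ck_on k (\<phi> ` U \<times> ?B) (\<lambda>z. (\<psi>' \<circ> (\<lambda>x. x) \<circ> inv_into V \<psi>) (snd z))"
    using smooth_map_chart[OF smooth_map_id[OF N] c(2) c']
    by (intro Ck_on_compose[OF manifold_finite_dim[OF N] _ B _ Ck_on_linear[OF bounded_linear_snd]])
      (auto simp: o_def open_Times B U)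
  then show "Ck_on k (\<theta> ` {z \<in> W. snd z \<in> V'}) (\<psi>' \<circ> snd \<circ> inv_into W \<theta>)"
    unfolding im
    by (rule Ck_on_cong[OF open_Times[OF U B], rotated])
      (auto simp: W inv_into_map_prod manifold_chart(4)[OF M c(1)] manifold_chart(4)[OF N c(2)])
qed

lemma smooth_map_Pair:
  assumes "manifold L" "manifold M" "manifold N" "smooth_map L M f" "smooth_map L N g"
  shows "smooth_map L (prod_mfd M N) (\<lambda>x. (f x, g x))"
proof (rule smooth_mapI)
  show cont: "continuous_map (mtop L) (mtop (prod_mfd M N)) (\<lambda>x. (f x, g x))"
    using assms(4,5)[THEN smooth_map_continuous] by (simp add: mtop_prod_mfd continuous_map_paired)
  fix U \<phi> W \<theta> k assume c: "(U, \<phi>) \<in> atlas L" and W: "(W, \<theta>) \<in> atlas (prod_mfd M N)"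
  obtain V \<psi> V' \<psi>' where c': "(V, \<psi>) \<in> atlas M" "(V', \<psi>') \<in> atlas N"
    and W': "W = V \<times> V'" "\<theta> = map_prod \<psi> \<psi>'" using W by (auto elim: atlas_prod_mfdE)
  let ?S = "\<phi> ` {x \<in> U. (f x, g x) \<in> W}"
  have "open ?S"
    by (rule open_chart_preimage[OF assms(1) manifold_prod[OF assms(2,3)] cont c W])
  moreover have "Ck_on k ?S (\<psi> \<circ> f \<circ> inv_into U \<phi>)"
    using smooth_map_chart[OF assms(4) c c'(1)] by (rule Ck_on_subset) (auto simp: W')
  moreover have "Ck_on k ?S (\<psi>' \<circ> g \<circ> inv_into U \<phi>)"
    using smooth_map_chart[OF assms(5) c c'(2)] by (rule Ck_on_subset) (auto simp: W')
  ultimately have "Ck_on k ?S (\<lambda>y. ((\<psi> \<circ> f \<circ> inv_into U \<phi>) y, (\<psi>' \<circ> g \<circ> inv_into U \<phi>) y))"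
    by (rule Ck_on_Pair)
  then show "Ck_on k ?S (\<theta> \<circ> (\<lambda>x. (f x, g x)) \<circ> inv_into U \<phi>)"
    by (simp add: W' o_def)
qed

section \<open>Crossed modules\<close>

text \<open>After \<open>m_assoc\<close> has nested products to the right, an element and its
  inverse are no longer a product of their own; these rules cancel them in that position.\<close>

lemma (in group) inv_cancel [simp]:
  "x \<in> carrier G \<Longrightarrow> y \<in> carrier G \<Longrightarrow> x \<otimes> (inv x \<otimes> y) = y"
  "x \<in> carrier G \<Longrightarrow> y \<in> carrier G \<Longrightarrow> inv x \<otimes> (x \<otimes> y) = y"
  by (simp_all flip: m_assoc)

locale crossed =
  fixes G :: "('g, 'eg::real_normed_vector) lie_grp"
    and H :: "('h, 'eh::real_normed_vector) lie_grp"
    and \<rho> :: "'g \<Rightarrow> 'h" and act :: "'h \<Rightarrow> 'g \<Rightarrow> 'g"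
  assumes crossed_module: "crossed_module G H \<rho> act"
begin

lemma lie_groups: "lie_group G" "lie_group H"
  using crossed_module by (auto simp: crossed_module_def)

sublocale G: group G using lie_groups by (simp add: lie_group_def)
sublocale H: group H using lie_groups by (simp add: lie_group_def)

lemma pts_G [simp]: "pts (gmfd G) = carrier G"
  and pts_H [simp]: "pts (gmfd H) = carrier H"
  and manifold_G: "manifold (gmfd G)"
  and manifold_H: "manifold (gmfd H)"
  using lie_groups by (simp_all add: lie_group_def)

lemma rho_closed [simp]: "g \<in> carrier G \<Longrightarrow> \<rho> g \<in> carrier H"
  and rho_mult [simp]:
    "g \<in> carrier G \<Longrightarrow> g' \<in> carrier G \<Longrightarrow> \<rho> (g \<otimes>\<^bsub>G\<^esub> g') = \<rho> g \<otimes>\<^bsub>H\<^esub> \<rho> g'"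
  using crossed_module by (auto simp: crossed_module_def lie_hom_def hom_def)

sublocale rho: group_hom G H \<rho>
  by unfold_locales (auto simp: hom_def)

lemma act_hom: "act \<in> hom H (lie_Aut G)"
  using crossed_module by (simp add: crossed_module_def)

lemma act_auto: "h \<in> carrier H \<Longrightarrow> act h \<in> auto G"
  using act_hom by (auto simp: hom_def lie_Aut_def)

lemma act_closed [simp]: "h \<in> carrier H \<Longrightarrow> g \<in> carrier G \<Longrightarrow> act h g \<in> carrier G"
  and act_mult [simp]: "h \<in> carrier H \<Longrightarrow> g \<in> carrier G \<Longrightarrow> g' \<in> carrier G \<Longrightarrow>
    act h (g \<otimes>\<^bsub>G\<^esub> g') = act h g \<otimes>\<^bsub>G\<^esub> act h g'"
  using act_auto[of h] by (auto simp: auto_def hom_def)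

text \<open>The product of \<open>lie_Aut G\<close> comes from \<open>BijGroup\<close>, where it is
  composition restricted to \<open>Bij\<close>; hence the membership facts.\<close>

lemma act_comp:
  assumes "h \<in> carrier H" "h' \<in> carrier H" "g \<in> carrier G"
  shows "act (h \<otimes>\<^bsub>H\<^esub> h') g = act h (act h' g)"
proof -
  have "act h \<in> Bij (carrier G)" "act h' \<in> Bij (carrier G)"
    using assms act_auto by (auto simp: auto_def)
  then have "act (h \<otimes>\<^bsub>H\<^esub> h') = compose (carrier G) (act h) (act h')"
    using act_hom assms by (auto simp: hom_def lie_Aut_def BijGroup_def)
  then show ?thesis using assms by (simp add: compose_def)
qed

lemma act_inj: "h \<in> carrier H \<Longrightarrow> inj_on (act h) (carrier G)"
  using act_auto[of h] by (auto simp: auto_def Bij_def bij_betw_def)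

text \<open>\<open>act_comp\<close> makes the action of the neutral element idempotent, and an
  injective idempotent map is the identity. This avoids showing that \<open>lie_Aut G\<close> is a
  group.\<close>

lemma act_one [simp]: "g \<in> carrier G \<Longrightarrow> act \<one>\<^bsub>H\<^esub> g = g"
  using act_comp[of "\<one>\<^bsub>H\<^esub>" "\<one>\<^bsub>H\<^esub>" g] act_inj[of "\<one>\<^bsub>H\<^esub>"] by (auto dest!: inj_onD)

lemma act_group_hom: "h \<in> carrier H \<Longrightarrow> group_hom G G (act h)"
  by unfold_locales (auto simp: hom_def)

lemma act_unit [simp]: "h \<in> carrier H \<Longrightarrow> act h \<one>\<^bsub>G\<^esub> = \<one>\<^bsub>G\<^esub>"
  using group_hom.hom_one[OF act_group_hom] .

lemma act_inv [simp]: "h \<in> carrier H \<Longrightarrow> g \<in> carrier G \<Longrightarrow> act h (inv\<^bsub>G\<^esub> g) = inv\<^bsub>G\<^esub> (act h g)"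
  using group_hom.hom_inv[OF act_group_hom] .

lemma act_inv_cancel:
  assumes "h \<in> carrier H" "g \<in> carrier G"
  shows "act h (act (inv\<^bsub>H\<^esub> h) g) = g" "act (inv\<^bsub>H\<^esub> h) (act h g) = g"
  using assms by (simp_all flip: act_comp)

lemma act_rho: "g \<in> carrier G \<Longrightarrow> g' \<in> carrier G \<Longrightarrow> act (\<rho> g) g' = g \<otimes>\<^bsub>G\<^esub> g' \<otimes>\<^bsub>G\<^esub> inv\<^bsub>G\<^esub> g"
  and rho_act: "h \<in> carrier H \<Longrightarrow> g \<in> carrier G \<Longrightarrow> \<rho> (act h g) = h \<otimes>\<^bsub>H\<^esub> \<rho> g \<otimes>\<^bsub>H\<^esub> inv\<^bsub>H\<^esub> h"
  using crossed_module by (simp_all add: crossed_module_def)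

section \<open>Smoothness of the crossed module operations applied to smooth maps\<close>

lemma smooth_mult_G:
  assumes "manifold L" "smooth_map L (gmfd G) f" "smooth_map L (gmfd G) g"
  shows "smooth_map L (gmfd G) (\<lambda>x. f x \<otimes>\<^bsub>G\<^esub> g x)"
  using smooth_map_compose[OF assms(1) manifold_prod[OF manifold_G manifold_G] manifold_G
      smooth_map_Pair[OF assms(1) manifold_G manifold_G assms(2,3)], of "\<lambda>(a, b). a \<otimes>\<^bsub>G\<^esub> b"]
    lie_groups(1)
  by (simp add: lie_group_def)

lemma smooth_mult_H:
  assumes "manifold L" "smooth_map L (gmfd H) f" "smooth_map L (gmfd H) g"
  shows "smooth_map L (gmfd H) (\<lambda>x. f x \<otimes>\<^bsub>H\<^esub> g x)"
  using smooth_map_compose[OF assms(1) manifold_prod[OF manifold_H manifold_H] manifold_H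
      smooth_map_Pair[OF assms(1) manifold_H manifold_H assms(2,3)], of "\<lambda>(a, b). a \<otimes>\<^bsub>H\<^esub> b"]
    lie_groups(2)
  by (simp add: lie_group_def)

lemma smooth_inv_G:
  assumes "manifold L" "smooth_map L (gmfd G) f"
  shows "smooth_map L (gmfd G) (\<lambda>x. inv\<^bsub>G\<^esub> (f x))"
  using smooth_map_compose[OF assms(1) manifold_G manifold_G assms(2)] lie_groups(1)
  by (simp add: lie_group_def)

lemma smooth_inv_H:
  assumes "manifold L" "smooth_map L (gmfd H) f"
  shows "smooth_map L (gmfd H) (\<lambda>x. inv\<^bsub>H\<^esub> (f x))"
  using smooth_map_compose[OF assms(1) manifold_H manifold_H assms(2)] lie_groups(2)
  by (simp add: lie_group_def)

lemma smooth_act: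
  assumes "manifold L" "smooth_map L (gmfd H) f" "smooth_map L (gmfd G) g"
  shows "smooth_map L (gmfd G) (\<lambda>x. act (f x) (g x))"
  using smooth_map_compose[OF assms(1) manifold_prod[OF manifold_H manifold_G] manifold_G
      smooth_map_Pair[OF assms(1) manifold_H manifold_G assms(2,3)], of "\<lambda>(h, g). act h g"]
    crossed_module
  by (simp add: crossed_module_def)

end

section \<open>Adapted extensions\<close>

locale adapted_ext = crossed G H \<rho> act
  for G :: "('g, 'eg::real_normed_vector) lie_grp"
    and H :: "('h, 'eh::real_normed_vector) lie_grp"
    and \<rho> :: "'g \<Rightarrow> 'h" and act :: "'h \<Rightarrow> 'g \<Rightarrow> 'g" +
  fixes N :: "('n, 'en::real_normed_vector) mfd"
    and I :: "'i set" and U :: "'i \<Rightarrow> 'n set"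
    and E :: "('i, 'n, 'en, 'g, 'eg, 'h, 'eh) cech_ext"
    and lam :: "('i \<times> 'i) \<times> 'n \<Rightarrow> 'h"
    and gg :: "('i \<times> 'i \<times> 'i) \<times> 'n \<Rightarrow> 'g"
  assumes cover: "open_cover N I U"
    and adapted: "adapted G H \<rho> act N I U E"
    and cocycle: "cocycle G H \<rho> act N I U lam gg"
    and associated: "associated G H I U E lam gg"
begin

abbreviation R where "R \<equiv> total E"

lemma pts_cover1: "pts (cover1 N I U) = Sigma I U"
  and pts_cover2: "pts (cover2 N I U) = (SIGMA (i, j):I \<times> I. U i \<inter> U j)"
  and pts_cover3: "pts (cover3 N I U) = (SIGMA (i, j, k):I \<times> I \<times> I. U i \<inter> U j \<inter> U k)"
proof -
  have "U i \<subseteq> pts N" if "i \<in> I" for i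
    using cover that by (auto simp: open_cover_def)
  then show "pts (cover1 N I U) = Sigma I U" "pts (cover2 N I U) = (SIGMA (i, j):I \<times> I. U i \<inter> U j)"
    "pts (cover3 N I U) = (SIGMA (i, j, k):I \<times> I \<times> I. U i \<inter> U j \<inter> U k)"
    by (force simp: cover1_def cover2_def cover3_def disj_union_def)+
qed

lemma GH_extension: "GH_extension G H \<rho> act (cech N I U) E"
  using adapted by (simp add: adapted_def)

lemma extension: "lie_groupoid_extension R (cech N I U) (eproj E)"
  using GH_extension by (simp add: GH_extension_def G_extension_def)

lemma lie_groupoid_R: "lie_groupoid R"
  and lie_groupoid_cech: "lie_groupoid (cech N I U)"
  and morphism_eproj: "groupoid_morphism R (cech N I U) (eproj E)"
  using extension by (simp_all add: lie_groupoid_extension_def)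

text \<open>These facts about disjoint unions are read off from the requirement that the base of an
  extension be a Lie groupoid.\<close>

lemma manifold_cover1: "manifold (cover1 N I U)"
  and manifold_cover2: "manifold (cover2 N I U)"
  and smooth_src_cech: "smooth_map (cover2 N I U) (cover1 N I U) (\<lambda>((i, j), x). (i, x))"
  using lie_groupoid_cech by (simp_all add: lie_groupoid_def cech_def surj_submersion_def submersion_def)

lemma manifold_arrows: "manifold (arrows R)"
  using lie_groupoid_R by (simp add: lie_groupoid_def)

lemma principal: "principal_bundle_over_groupoid H R (ptot E) (bproj E) (ract E) (lact E)"
  using GH_extension by (simp add: GH_extension_def)

lemma manifold_ptot: "manifold (ptot E)"
  using principal by (simp add: principal_bundle_over_groupoid_def principal_bundle_def)

lemma objects_R: "objects R = cover1 N I U"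
  using morphism_eproj by (simp add: groupoid_morphism_def cech_def)

lemma same_arrows: "same_manifold (arrows R) (prod_mfd (gmfd G) (cover2 N I U))"
  and same_ptot: "same_manifold (ptot E) (prod_mfd (cover1 N I U) (gmfd H))"
  using adapted by (simp_all add: adapted_def)

lemma Arr_R: "Arr R = carrier G \<times> pts (cover2 N I U)"
proof -
  have "Arr R = pts (prod_mfd (gmfd G) (cover2 N I U))"
    using same_arrows by (simp add: same_manifold_def)
  then show ?thesis by simp
qed

lemma pts_ptot: "pts (ptot E) = pts (cover1 N I U) \<times> carrier H"
proof -
  have "pts (ptot E) = pts (prod_mfd (cover1 N I U) (gmfd H))"
    using same_ptot by (simp add: same_manifold_def)
  then show ?thesis by simp
qed

lemma lam_closed [simp]: "i \<in> I \<Longrightarrow> j \<in> I \<Longrightarrow> x \<in> U i \<Longrightarrow> x \<in> U j \<Longrightarrow> lam ((i, j), x) \<in> carrier H"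
  using cocycle smooth_map_in_pts[of "cover2 N I U" "gmfd H" lam "((i, j), x)"]
  by (auto simp: cocycle_def C_inf_def pts_cover2)

lemma gg_closed [simp]: "i \<in> I \<Longrightarrow> j \<in> I \<Longrightarrow> k \<in> I \<Longrightarrow> x \<in> U i \<Longrightarrow> x \<in> U j \<Longrightarrow> x \<in> U k \<Longrightarrow>
    gg ((i, j, k), x) \<in> carrier G"
  using cocycle smooth_map_in_pts[of "cover3 N I U" "gmfd G" gg "((i, j, k), x)"]
  by (auto simp: cocycle_def C_inf_def pts_cover3)

lemma gg_unit: "i \<in> I \<Longrightarrow> j \<in> I \<Longrightarrow> x \<in> U i \<Longrightarrow> x \<in> U j \<Longrightarrow> gg ((i, i, j), x) = \<one>\<^bsub>G\<^esub>"
  using cocycle by (simp add: cocycle_def)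

lemma arrow_in [simp]: "g \<in> carrier G \<Longrightarrow> i \<in> I \<Longrightarrow> j \<in> I \<Longrightarrow> x \<in> U i \<Longrightarrow> x \<in> U j \<Longrightarrow> (g, ((i, j), x)) \<in> Arr R"
  by (simp add: Arr_R pts_cover2)

lemma point_in [simp]: "i \<in> I \<Longrightarrow> x \<in> U i \<Longrightarrow> h \<in> carrier H \<Longrightarrow> ((i, x), h) \<in> pts (ptot E)"
  by (simp add: pts_ptot pts_cover1)

lemma eproj_eq: "g \<in> carrier G \<Longrightarrow> a \<in> pts (cover2 N I U) \<Longrightarrow> eproj E (g, a) = a"
  using adapted by (simp add: adapted_def)

lemma bproj_eq: "m \<in> pts (cover1 N I U) \<Longrightarrow> h \<in> carrier H \<Longrightarrow> bproj E (m, h) = m"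
  using adapted by (simp add: adapted_def)

lemma bproj_point [simp]: "i \<in> I \<Longrightarrow> x \<in> U i \<Longrightarrow> h \<in> carrier H \<Longrightarrow> bproj E ((i, x), h) = (i, x)"
  by (simp add: bproj_eq pts_cover1)

lemma ract_eq [simp]: "i \<in> I \<Longrightarrow> x \<in> U i \<Longrightarrow> h \<in> carrier H \<Longrightarrow> h' \<in> carrier H \<Longrightarrow>
    ract E ((i, x), h) h' = ((i, x), h \<otimes>\<^bsub>H\<^esub> h')"
  using adapted by (simp add: adapted_def pts_cover1)

lemma chi_eq: "i \<in> I \<Longrightarrow> x \<in> U i \<Longrightarrow> h \<in> carrier H \<Longrightarrow>
    chi E ((i, x), h) = (\<lambda>g\<in>carrier G. (act h g, ((i, i), x)))"
  using adapted by (simp add: adapted_def)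

text \<open>Adaptedness does not prescribe source and target. They are forced because
  \<open>eproj E\<close> is a morphism over the identity of the base and sends an arrow to its
  second component.\<close>

lemma src_tgt_R [simp]:
  assumes "g \<in> carrier G" "i \<in> I" "j \<in> I" "x \<in> U i" "x \<in> U j"
  shows "src R (g, ((i, j), x)) = (i, x)" "tgt R (g, ((i, j), x)) = (j, x)"
proof -
  have a: "((i, j), x) \<in> pts (cover2 N I U)" using assms by (simp add: pts_cover2)
  have "src (cech N I U) (eproj E (g, ((i, j), x))) = src R (g, ((i, j), x))"
    "tgt (cech N I U) (eproj E (g, ((i, j), x))) = tgt R (g, ((i, j), x))"
    using morphism_eproj assms unfolding groupoid_morphism_def by (auto simp: Arr_R pts_cover2)
  then show "src R (g, ((i, j), x)) = (i, x)" "tgt R (g, ((i, j), x)) = (j, x)"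
    using eproj_eq[OF assms(1) a] by (simp_all add: cech_def)
qed

lemma gprod_closed: "a \<in> Arr R \<Longrightarrow> b \<in> Arr R \<Longrightarrow> tgt R a = src R b \<Longrightarrow> gprod R a b \<in> Arr R"
  and gprod_tgt: "a \<in> Arr R \<Longrightarrow> b \<in> Arr R \<Longrightarrow> tgt R a = src R b \<Longrightarrow> tgt R (gprod R a b) = tgt R b"
  using lie_groupoid_R by (auto simp: lie_groupoid_def)

lemma gprod_assoc: "a \<in> Arr R \<Longrightarrow> b \<in> Arr R \<Longrightarrow> c \<in> Arr R \<Longrightarrow> tgt R a = src R b \<Longrightarrow> tgt R b = src R c \<Longrightarrow>
    gprod R (gprod R a b) c = gprod R a (gprod R b c)"
  using lie_groupoid_R by (simp add: lie_groupoid_def)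

lemma gprod_ident: "a \<in> Arr R \<Longrightarrow> gprod R (ident R (src R a)) a = a"
   "a \<in> Arr R \<Longrightarrow> gprod R a (ident R (tgt R a)) = a"
  using lie_groupoid_R by (simp_all add: lie_groupoid_def)

lemma ginv_facts: "a \<in> Arr R \<Longrightarrow> ginv R a \<in> Arr R"
  "a \<in> Arr R \<Longrightarrow> src R (ginv R a) = tgt R a" "a \<in> Arr R \<Longrightarrow> tgt R (ginv R a) = src R a"
  "a \<in> Arr R \<Longrightarrow> gprod R (ginv R a) a = ident R (tgt R a)"
proof -
  \<comment> \<open>\<open>lie_groupoid\<close> states no closure condition for \<open>ginv\<close>;
    it is contained in the continuity of a smooth map.\<close>
  have "smooth_map (arrows R) (arrows R) (ginv R)"
    using lie_groupoid_R by (simp add: lie_groupoid_def)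
  then show "a \<in> Arr R \<Longrightarrow> ginv R a \<in> Arr R" by (rule smooth_map_in_pts)
qed (use lie_groupoid_R in \<open>simp_all add: lie_groupoid_def\<close>)

lemma gprod_isotropy:
  assumes "i \<in> I" "j \<in> I" "x \<in> U i" "x \<in> U j" "g \<in> carrier G" "g' \<in> carrier G"
  shows "gprod R (g, ((i, i), x)) (g', ((i, j), x)) = (g \<otimes>\<^bsub>G\<^esub> g', ((i, j), x))"
  using adapted assms by (simp add: adapted_def)

text \<open>The projection preserves units, so the unit has the form
  \<open>(g, ((i, i), x))\<close>. The left unit law at the arrow with neutral first component,
  computed by \<open>gprod_isotropy\<close>, leaves only the neutral \<open>g\<close>.\<close>

lemma ident_R:
  assumes "i \<in> I" "x \<in> U i"
  shows "ident R (i, x) = (\<one>\<^bsub>G\<^esub>, ((i, i), x))"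
proof -
  have m: "(i, x) \<in> Obj R" using assms by (simp add: objects_R pts_cover1)
  have "smooth_map (objects R) (arrows R) (ident R)"
    using lie_groupoid_R by (simp add: lie_groupoid_def)
  then have "ident R (i, x) \<in> Arr R" using m by (rule smooth_map_in_pts)
  then obtain g a where ga: "ident R (i, x) = (g, a)" "g \<in> carrier G" "a \<in> pts (cover2 N I U)"
    by (auto simp: Arr_R)
  have "eproj E (ident R (i, x)) = ((i, i), x)"
    using morphism_eproj m by (simp add: groupoid_morphism_def cech_def)
  then have a: "a = ((i, i), x)" using ga eproj_eq by simp
  have "gprod R (ident R (i, x)) (\<one>\<^bsub>G\<^esub>, ((i, i), x)) = (\<one>\<^bsub>G\<^esub>, ((i, i), x))"
    using gprod_ident(1)[of "(\<one>\<^bsub>G\<^esub>, ((i, i), x))"] assms by simp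
  then show ?thesis
    using ga a assms by (simp add: gprod_isotropy)
qed

section \<open>Product and action in terms of the cocycle\<close>

lemma gprod_unit:
  assumes "i \<in> I" "j \<in> I" "k \<in> I" "x \<in> U i" "x \<in> U j" "x \<in> U k"
  shows "gprod R (\<one>\<^bsub>G\<^esub>, ((i, j), x)) (\<one>\<^bsub>G\<^esub>, ((j, k), x)) = (gg ((i, j, k), x), ((i, k), x))"
  using associated assms by (simp add: associated_def)

lemma lact_unit:
  assumes "i \<in> I" "j \<in> I" "x \<in> U i" "x \<in> U j"
  shows "lact E (\<one>\<^bsub>G\<^esub>, ((i, j), x)) ((j, x), \<one>\<^bsub>H\<^esub>) = ((i, x), lam ((i, j), x))"
  using associated assms by (simp add: associated_def)

text \<open>Equivariance of \<open>\<chi>\<close> at \<open>(x\<^sub>j, e)\<close> says that conjugation by \<open>(e, x\<^sub>i\<^sub>j)\<close> acts on the kernel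
  through \<open>\<lambda>\<^sub>i\<^sub>j\<close>.\<close>

lemma gprod_unit_isotropy:
  assumes "i \<in> I" "j \<in> I" "x \<in> U i" "x \<in> U j" "g \<in> carrier G"
  shows "gprod R (\<one>\<^bsub>G\<^esub>, ((i, j), x)) (g, ((j, j), x)) = (act (lam ((i, j), x)) g, ((i, j), x))"
proof -
  let ?e = "(\<one>\<^bsub>G\<^esub>, ((i, j), x))" and ?b = "(g, ((j, j), x))" and ?p = "((j, x), \<one>\<^bsub>H\<^esub>)"
  have in_R: "?e \<in> Arr R" "?b \<in> Arr R" "?p \<in> pts (ptot E)" using assms by simp_all
  have eb: "gprod R ?e ?b \<in> Arr R" "tgt R (gprod R ?e ?b) = (j, x)"
    using gprod_closed[OF in_R(1,2)] gprod_tgt[OF in_R(1,2)] assms by simp_all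
  have "chi E (ract E (lact E ?e ?p) \<one>\<^bsub>H\<^esub>) = band_ract G (band_lact G R ?e (chi E ?p)) (act \<one>\<^bsub>H\<^esub>)"
    using GH_extension in_R assms unfolding GH_extension_def by simp
  then have "chi E (ract E (lact E ?e ?p) \<one>\<^bsub>H\<^esub>) g = band_ract G (band_lact G R ?e (chi E ?p)) (act \<one>\<^bsub>H\<^esub>) g"
    by simp
  then have "(act (lam ((i, j), x)) g, ((i, i), x)) = gprod R (gprod R ?e ?b) (ginv R ?e)"
    using assms by (simp add: lact_unit chi_eq band_ract_def band_lact_def compose_def)
  \<comment> \<open>Multiplying by \<open>?e\<close> on the right removes the inverse from the
    conjugation, and \<open>gprod_isotropy\<close> evaluates the other side.\<close>
  then have "gprod R (act (lam ((i, j), x)) g, ((i, i), x)) ?e = gprod R (gprod R (gprod R ?e ?b) (ginv R ?e)) ?e"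
    by simp
  also have "\<dots> = gprod R (gprod R ?e ?b) (gprod R (ginv R ?e) ?e)"
    using in_R eb assms by (intro gprod_assoc ginv_facts) (simp_all add: ginv_facts)
  also have "\<dots> = gprod R ?e ?b"
    using gprod_ident(2)[OF eb(1)] eb(2) in_R assms by (simp add: ginv_facts)
  finally show ?thesis
    using assms by (simp add: gprod_isotropy)
qed

lemma gprod_eq:
  assumes "i \<in> I" "j \<in> I" "k \<in> I" "x \<in> U i" "x \<in> U j" "x \<in> U k" "g \<in> carrier G" "g' \<in> carrier G"
  shows "gprod R (g, ((i, j), x)) (g', ((j, k), x)) =
    (g \<otimes>\<^bsub>G\<^esub> act (lam ((i, j), x)) g' \<otimes>\<^bsub>G\<^esub> gg ((i, j, k), x), ((i, k), x))"
proof -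
  let ?e = "(\<one>\<^bsub>G\<^esub>, ((i, j), x))" and ?e' = "(\<one>\<^bsub>G\<^esub>, ((j, k), x))"
    and ?g = "(g, ((i, i), x))" and ?g' = "(g', ((j, j), x))" and ?l = "act (lam ((i, j), x)) g'"
  have "gprod R (g, ((i, j), x)) (g', ((j, k), x)) = gprod R (gprod R ?g ?e) (gprod R ?g' ?e')"
    using assms by (simp add: gprod_isotropy)
  also have "\<dots> = gprod R ?g (gprod R ?e (gprod R ?g' ?e'))"
    using assms by (intro gprod_assoc) (simp_all add: gprod_isotropy)
  \<comment> \<open>Reassociation brings \<open>?e\<close> next to the kernel arrow
    \<open>?g'\<close>, which it can then pass at the cost of applying
    \<open>lam ((i, j), x)\<close>.\<close>
  also have "gprod R ?e (gprod R ?g' ?e') = gprod R (gprod R ?e ?g') ?e'"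
    using assms by (intro gprod_assoc[symmetric]) simp_all
  also have "\<dots> = gprod R (gprod R (?l, ((i, i), x)) ?e) ?e'"
    using assms by (simp add: gprod_unit_isotropy gprod_isotropy)
  also have "\<dots> = gprod R (?l, ((i, i), x)) (gprod R ?e ?e')"
    using assms by (intro gprod_assoc) simp_all
  finally show ?thesis
    using assms by (simp add: gprod_unit gprod_isotropy G.m_assoc)
qed

lemma lact_gprod:
  assumes "a \<in> Arr R" "b \<in> Arr R" "p \<in> pts (ptot E)" "tgt R a = src R b" "tgt R b = bproj E p"
  shows "lact E (gprod R a b) p = lact E a (lact E b p)"
  using principal assms by (simp add: principal_bundle_over_groupoid_def left_action_def)

lemma lact_ract:
  assumes "a \<in> Arr R" "p \<in> pts (ptot E)" "h \<in> carrier H" "tgt R a = bproj E p"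
  shows "lact E a (ract E p h) = ract E (lact E a p) h"
  using principal assms by (simp add: principal_bundle_over_groupoid_def)

text \<open>At a point with neutral fibre component \<open>chi\<close> is just the inclusion of G as
  the kernel fibre, so the compatibility of \<open>\<rho>\<close> with the two actions gives this
  case. Commutation with the right action gives general \<open>h\<close>.\<close>

lemma lact_isotropy:
  assumes "i \<in> I" "x \<in> U i" "g \<in> carrier G" "h \<in> carrier H"
  shows "lact E (g, ((i, i), x)) ((i, x), h) = ((i, x), \<rho> g \<otimes>\<^bsub>H\<^esub> h)"
proof -
  have "ract E ((i, x), \<one>\<^bsub>H\<^esub>) (\<rho> g) = lact E (chi E ((i, x), \<one>\<^bsub>H\<^esub>) g) ((i, x), \<one>\<^bsub>H\<^esub>)"
    using GH_extension assms unfolding GH_extension_def by simp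
  then have "lact E (g, ((i, i), x)) ((i, x), \<one>\<^bsub>H\<^esub>) = ((i, x), \<rho> g)"
    using assms by (simp add: chi_eq)
  then show ?thesis
    using lact_ract[of "(g, ((i, i), x))" "((i, x), \<one>\<^bsub>H\<^esub>)" h] assms by simp
qed

lemma lact_eq:
  assumes "i \<in> I" "j \<in> I" "x \<in> U i" "x \<in> U j" "g \<in> carrier G" "h \<in> carrier H"
  shows "lact E (g, ((i, j), x)) ((j, x), h) = ((i, x), \<rho> g \<otimes>\<^bsub>H\<^esub> lam ((i, j), x) \<otimes>\<^bsub>H\<^esub> h)"
proof -
  have "lact E (\<one>\<^bsub>G\<^esub>, ((i, j), x)) ((j, x), h) = ((i, x), lam ((i, j), x) \<otimes>\<^bsub>H\<^esub> h)"
    using lact_ract[of "(\<one>\<^bsub>G\<^esub>, ((i, j), x))" "((j, x), \<one>\<^bsub>H\<^esub>)" h] assms by (simp add: lact_unit)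
  then have "lact E (gprod R (g, ((i, i), x)) (\<one>\<^bsub>G\<^esub>, ((i, j), x))) ((j, x), h)
      = ((i, x), \<rho> g \<otimes>\<^bsub>H\<^esub> (lam ((i, j), x) \<otimes>\<^bsub>H\<^esub> h))"
    using assms by (simp add: lact_gprod lact_isotropy)
  then show ?thesis using assms by (simp add: gprod_isotropy H.m_assoc)
qed

end

section \<open>Isomorphisms and coboundaries\<close>

locale adapted_pair =
  E: adapted_ext G H \<rho> act N I U E lam gg + E': adapted_ext G H \<rho> act N I U E' lam' gg'
  for G :: "('g, 'eg::real_normed_vector) lie_grp"
    and H :: "('h, 'eh::real_normed_vector) lie_grp"
    and \<rho> :: "'g \<Rightarrow> 'h" and act :: "'h \<Rightarrow> 'g \<Rightarrow> 'g"
    and N :: "('n, 'en::real_normed_vector) mfd"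
    and I :: "'i set" and U :: "'i \<Rightarrow> 'n set"
    and E :: "('i, 'n, 'en, 'g, 'eg, 'h, 'eh) cech_ext"
    and lam :: "('i \<times> 'i) \<times> 'n \<Rightarrow> 'h"
    and gg :: "('i \<times> 'i \<times> 'i) \<times> 'n \<Rightarrow> 'g"
    and E' :: "('i, 'n, 'en, 'g, 'eg, 'h, 'eh) cech_ext"
    and lam' :: "('i \<times> 'i) \<times> 'n \<Rightarrow> 'h"
    and gg' :: "('i \<times> 'i \<times> 'i) \<times> 'n \<Rightarrow> 'g"
begin

abbreviation "GC2 \<equiv> prod_mfd (gmfd G) (cover2 N I U)"
abbreviation "C1H \<equiv> prod_mfd (cover1 N I U) (gmfd H)"

lemma manifold_GC2: "manifold GC2"
  and manifold_C1H: "manifold C1H"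
  by (simp_all add: manifold_prod E.manifold_G E.manifold_H E.manifold_cover1 E.manifold_cover2)

text \<open>All smoothness questions move to the product manifolds. Both directions between
  \<open>E\<close> and \<open>E'\<close> are covered because \<open>diffeo\<close> also concerns the
  inverse.\<close>

lemma smooth_arrows_iff: "smooth_map (arrows E.R) (arrows E'.R) f \<longleftrightarrow> smooth_map GC2 GC2 f"
  and smooth_ptot_iff: "smooth_map (ptot E) (ptot E') f' \<longleftrightarrow> smooth_map C1H C1H f'"
  and smooth_arrows_iff': "smooth_map (arrows E'.R) (arrows E.R) f \<longleftrightarrow> smooth_map GC2 GC2 f"
  and smooth_ptot_iff': "smooth_map (ptot E') (ptot E) f' \<longleftrightarrow> smooth_map C1H C1H f'"
  by (meson smooth_map_same_manifold same_manifold_sym manifold_GC2 manifold_C1H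
      E.manifold_arrows E'.manifold_arrows E.manifold_ptot E'.manifold_ptot
      E.same_arrows E'.same_arrows E.same_ptot E'.same_ptot)+

section \<open>From an isomorphism to a coboundary\<close>

context
  fixes \<Phi> \<Psi> r v
  assumes iso: "(\<Phi>, \<Psi>) \<in> GH_isos G H E E'"
    and rv: "(r, v) = coboundary_of_iso G H N I U (\<Phi>, \<Psi>)"
begin

lemma r_eq: "r = (\<lambda>m\<in>pts (cover1 N I U). snd (\<Psi> (m, \<one>\<^bsub>H\<^esub>)))"
  and v_eq: "v = (\<lambda>a\<in>pts (cover2 N I U). inv\<^bsub>G\<^esub> (fst (\<Phi> (\<one>\<^bsub>G\<^esub>, a))))"
  using rv by (simp_all add: coboundary_of_iso_def)

lemma smooth_iso: "smooth_map GC2 GC2 \<Phi>" "smooth_map C1H C1H \<Psi>"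
  using iso by (simp_all add: GH_isos_def diffeo_def smooth_arrows_iff smooth_ptot_iff)

lemma smooth_r: "smooth_map (cover1 N I U) (gmfd H) r"
proof -
  have "smooth_map (cover1 N I U) C1H (\<lambda>m. (m, \<one>\<^bsub>H\<^esub>))"
    by (intro smooth_map_Pair smooth_map_id smooth_map_const E.manifold_cover1 E.manifold_H) simp
  from smooth_map_compose[OF E.manifold_cover1 manifold_C1H manifold_C1H this smooth_iso(2)]
  have "smooth_map (cover1 N I U) C1H (\<lambda>m. \<Psi> (m, \<one>\<^bsub>H\<^esub>))" .
  from smooth_map_compose[OF E.manifold_cover1 manifold_C1H E.manifold_H this
      smooth_map_snd[OF E.manifold_cover1 E.manifold_H]]
  have "smooth_map (cover1 N I U) (gmfd H) (\<lambda>m. snd (\<Psi> (m, \<one>\<^bsub>H\<^esub>)))" .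
  then show ?thesis
    by (rule smooth_map_cong[OF E.manifold_cover1 E.manifold_H]) (simp add: r_eq)
qed

lemma smooth_v: "smooth_map (cover2 N I U) (gmfd G) v"
proof -
  have "smooth_map (cover2 N I U) GC2 (\<lambda>a. (\<one>\<^bsub>G\<^esub>, a))"
    by (intro smooth_map_Pair smooth_map_id smooth_map_const E.manifold_cover2 E.manifold_G) simp
  from smooth_map_compose[OF E.manifold_cover2 manifold_GC2 manifold_GC2 this smooth_iso(1)]
  have "smooth_map (cover2 N I U) GC2 (\<lambda>a. \<Phi> (\<one>\<^bsub>G\<^esub>, a))" .
  from smooth_map_compose[OF E.manifold_cover2 manifold_GC2 E.manifold_G this
      smooth_map_fst[OF E.manifold_G E.manifold_cover2]]
  have "smooth_map (cover2 N I U) (gmfd G) (\<lambda>a. inv\<^bsub>G\<^esub> (fst (\<Phi> (\<one>\<^bsub>G\<^esub>, a))))"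
    by (rule E.smooth_inv_G[OF E.manifold_cover2])
  then show ?thesis
    by (rule smooth_map_cong[OF E.manifold_cover2 E.manifold_G]) (simp add: v_eq)
qed

lemma r_closed: "i \<in> I \<Longrightarrow> x \<in> U i \<Longrightarrow> r (i, x) \<in> carrier H"
  using smooth_map_in_pts[OF smooth_r, of "(i, x)"] by (simp add: E.pts_cover1)

lemma v_closed: "i \<in> I \<Longrightarrow> j \<in> I \<Longrightarrow> x \<in> U i \<Longrightarrow> x \<in> U j \<Longrightarrow> v ((i, j), x) \<in> carrier G"
  using smooth_map_in_pts[OF smooth_v, of "((i, j), x)"] by (simp add: E.pts_cover2)

lemmas rv_closed = r_closed v_closed

lemma Phi_gprod: "a \<in> Arr E.R \<Longrightarrow> b \<in> Arr E.R \<Longrightarrow> tgt E.R a = src E.R b \<Longrightarrow>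
    \<Phi> (gprod E.R a b) = gprod E'.R (\<Phi> a) (\<Phi> b)"
  using iso by (simp add: GH_isos_def groupoid_morphism_def)

lemma Psi_equivariant: "a \<in> Arr E.R \<Longrightarrow> p \<in> pts (ptot E) \<Longrightarrow> h \<in> carrier H \<Longrightarrow> tgt E.R a = bproj E p \<Longrightarrow>
    \<Psi> (ract E (lact E a p) h) = ract E' (lact E' (\<Phi> a) (\<Psi> p)) h"
  using iso by (simp add: GH_isos_def)

lemma Psi_unit:
  assumes "i \<in> I" "x \<in> U i"
  shows "\<Psi> ((i, x), \<one>\<^bsub>H\<^esub>) = ((i, x), r (i, x))"
proof -
  have "\<Psi> ((i, x), \<one>\<^bsub>H\<^esub>) \<in> pts C1H"
    using assms by (intro smooth_map_in_pts[OF smooth_iso(2)]) (simp add: E.pts_cover1)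
  then obtain m h where mh: "\<Psi> ((i, x), \<one>\<^bsub>H\<^esub>) = (m, h)" "m \<in> pts (cover1 N I U)" "h \<in> carrier H"
    by (cases "\<Psi> ((i, x), \<one>\<^bsub>H\<^esub>)") auto
  have "bproj E' (\<Psi> ((i, x), \<one>\<^bsub>H\<^esub>)) = bproj E ((i, x), \<one>\<^bsub>H\<^esub>)"
    using iso assms by (simp add: GH_isos_def)
  then show ?thesis
    using mh assms by (simp add: E'.bproj_eq r_eq E.pts_cover1)
qed

lemma Phi_unit:
  assumes "i \<in> I" "j \<in> I" "x \<in> U i" "x \<in> U j"
  shows "\<Phi> (\<one>\<^bsub>G\<^esub>, ((i, j), x)) = (inv\<^bsub>G\<^esub> (v ((i, j), x)), ((i, j), x))"
proof -
  let ?a = "(\<one>\<^bsub>G\<^esub>, ((i, j), x))"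
  have "\<Phi> ?a \<in> pts GC2"
    using assms by (intro smooth_map_in_pts[OF smooth_iso(1)]) (simp add: E.pts_cover2)
  then obtain g b where gb: "\<Phi> ?a = (g, b)" "g \<in> carrier G" "b \<in> pts (cover2 N I U)"
    by (cases "\<Phi> ?a") auto
  have "eproj E' (\<Phi> ?a) = eproj E ?a"
    using iso assms by (simp add: GH_isos_def)
  then show ?thesis
    using gb assms by (simp add: E'.eproj_eq E.eproj_eq v_eq E.pts_cover2)
qed

text \<open>Equivariance is given jointly for both actions. Acting with a unit arrow, which \<Phi>
  preserves, isolates the right H-action.\<close>

lemma Psi_eq:
  assumes "i \<in> I" "x \<in> U i" "h \<in> carrier H"
  shows "\<Psi> ((i, x), h) = ((i, x), r (i, x) \<otimes>\<^bsub>H\<^esub> h)"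
proof -
  have "\<Phi> (ident E.R (i, x)) = ident E'.R (i, x)"
    using iso assms by (simp add: GH_isos_def groupoid_morphism_def E.objects_R E.pts_cover1)
  then have "\<Phi> (\<one>\<^bsub>G\<^esub>, ((i, i), x)) = (\<one>\<^bsub>G\<^esub>, ((i, i), x))"
    using assms by (simp add: E.ident_R E'.ident_R)
  then show ?thesis
    using Psi_equivariant[of "(\<one>\<^bsub>G\<^esub>, ((i, i), x))" "((i, x), \<one>\<^bsub>H\<^esub>)" h] assms
    by (simp add: E.lact_isotropy E'.lact_isotropy Psi_unit rv_closed)
qed

text \<open>Compatibility with \<open>chi\<close> at \<open>((i, x), e)\<close> says that \<Phi>
  acts on the kernel over that point by \<open>act (r (i, x))\<close>; multiplicativity extends this
  to all arrows.\<close>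

lemma Phi_eq:
  assumes "i \<in> I" "j \<in> I" "x \<in> U i" "x \<in> U j" "g \<in> carrier G"
  shows "\<Phi> (g, ((i, j), x)) = (act (r (i, x)) g \<otimes>\<^bsub>G\<^esub> inv\<^bsub>G\<^esub> (v ((i, j), x)), ((i, j), x))"
proof -
  have "chi E' (\<Psi> ((i, x), \<one>\<^bsub>H\<^esub>)) = (\<lambda>g\<in>carrier G. \<Phi> (chi E ((i, x), \<one>\<^bsub>H\<^esub>) g))"
    using iso assms by (simp add: GH_isos_def)
  then have "chi E' (\<Psi> ((i, x), \<one>\<^bsub>H\<^esub>)) g = \<Phi> (chi E ((i, x), \<one>\<^bsub>H\<^esub>) g)"
    using assms by simp
  then have "\<Phi> (g, ((i, i), x)) = (act (r (i, x)) g, ((i, i), x))"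
    using assms by (simp add: Psi_unit E.chi_eq E'.chi_eq rv_closed)
  moreover have "\<Phi> (gprod E.R (g, ((i, i), x)) (\<one>\<^bsub>G\<^esub>, ((i, j), x))) =
      gprod E'.R (\<Phi> (g, ((i, i), x))) (\<Phi> (\<one>\<^bsub>G\<^esub>, ((i, j), x)))"
    using assms by (intro Phi_gprod) simp_all
  ultimately show ?thesis
    using assms by (simp add: E.gprod_isotropy E'.gprod_isotropy Phi_unit rv_closed)
qed

lemma coboundary_of_iso_relates: "(r, v) \<in> coboundaries_relating G H \<rho> act N I U lam gg lam' gg'"
proof -
  have "(r, v) \<in> coboundaries G H N I U"
    using smooth_r smooth_v by (simp add: coboundaries_def C_inf_def) (simp add: r_eq v_eq)
  moreover have "lam' ((i, j), x) =
      \<rho> (v ((i, j), x)) \<otimes>\<^bsub>H\<^esub> r (i, x) \<otimes>\<^bsub>H\<^esub> lam ((i, j), x) \<otimes>\<^bsub>H\<^esub> inv\<^bsub>H\<^esub> (r (j, x))"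
    if ij: "i \<in> I" "j \<in> I" "x \<in> U i" "x \<in> U j" for i j x
  proof -
    have "\<Psi> (ract E (lact E (\<one>\<^bsub>G\<^esub>, ((i, j), x)) ((j, x), \<one>\<^bsub>H\<^esub>)) \<one>\<^bsub>H\<^esub>) =
        ract E' (lact E' (\<Phi> (\<one>\<^bsub>G\<^esub>, ((i, j), x))) (\<Psi> ((j, x), \<one>\<^bsub>H\<^esub>))) \<one>\<^bsub>H\<^esub>"
      using ij by (intro Psi_equivariant) simp_all
    then have "r (i, x) \<otimes>\<^bsub>H\<^esub> lam ((i, j), x) =
        inv\<^bsub>H\<^esub> (\<rho> (v ((i, j), x))) \<otimes>\<^bsub>H\<^esub> lam' ((i, j), x) \<otimes>\<^bsub>H\<^esub> r (j, x)"
      using ij by (simp add: E.lact_unit E'.lact_eq Phi_unit Psi_unit Psi_eq rv_closed)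
    \<comment> \<open>Multiplication on both sides isolates \<open>lam'\<close>.\<close>
    then have "\<rho> (v ((i, j), x)) \<otimes>\<^bsub>H\<^esub> (r (i, x) \<otimes>\<^bsub>H\<^esub> lam ((i, j), x)) \<otimes>\<^bsub>H\<^esub> inv\<^bsub>H\<^esub> (r (j, x)) =
        \<rho> (v ((i, j), x)) \<otimes>\<^bsub>H\<^esub> (inv\<^bsub>H\<^esub> (\<rho> (v ((i, j), x))) \<otimes>\<^bsub>H\<^esub> lam' ((i, j), x) \<otimes>\<^bsub>H\<^esub> r (j, x)) \<otimes>\<^bsub>H\<^esub>
          inv\<^bsub>H\<^esub> (r (j, x))" by simp
    then show ?thesis
      using ij by (simp add: rv_closed E.H.m_assoc)
  qed
  moreover have "gg' ((i, j, k), x) \<otimes>\<^bsub>G\<^esub> v ((i, k), x) =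
      act (lam' ((i, j), x)) (v ((j, k), x)) \<otimes>\<^bsub>G\<^esub> v ((i, j), x) \<otimes>\<^bsub>G\<^esub> act (r (i, x)) (gg ((i, j, k), x))"
    if ijk: "i \<in> I" "j \<in> I" "k \<in> I" "x \<in> U i" "x \<in> U j" "x \<in> U k" for i j k x
  proof -
    let ?X = "act (r (i, x)) (gg ((i, j, k), x))" and ?b = "act (lam' ((i, j), x)) (v ((j, k), x))"
    have "\<Phi> (gprod E.R (\<one>\<^bsub>G\<^esub>, ((i, j), x)) (\<one>\<^bsub>G\<^esub>, ((j, k), x))) =
        gprod E'.R (\<Phi> (\<one>\<^bsub>G\<^esub>, ((i, j), x))) (\<Phi> (\<one>\<^bsub>G\<^esub>, ((j, k), x)))"
      using ijk by (intro Phi_gprod) simp_all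
    then have "?X \<otimes>\<^bsub>G\<^esub> inv\<^bsub>G\<^esub> (v ((i, k), x)) =
        inv\<^bsub>G\<^esub> (v ((i, j), x)) \<otimes>\<^bsub>G\<^esub> inv\<^bsub>G\<^esub> ?b \<otimes>\<^bsub>G\<^esub> gg' ((i, j, k), x)"
      using ijk by (simp add: E.gprod_unit E'.gprod_eq Phi_unit Phi_eq rv_closed)
    \<comment> \<open>The left factor is inverse to the first two factors of the right-hand side
      above; the right factor clears the inverse of \<open>v ((i, k), x)\<close>.\<close>
    then have "?b \<otimes>\<^bsub>G\<^esub> v ((i, j), x) \<otimes>\<^bsub>G\<^esub> (?X \<otimes>\<^bsub>G\<^esub> inv\<^bsub>G\<^esub> (v ((i, k), x))) \<otimes>\<^bsub>G\<^esub> v ((i, k), x) =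
        ?b \<otimes>\<^bsub>G\<^esub> v ((i, j), x) \<otimes>\<^bsub>G\<^esub> (inv\<^bsub>G\<^esub> (v ((i, j), x)) \<otimes>\<^bsub>G\<^esub> inv\<^bsub>G\<^esub> ?b \<otimes>\<^bsub>G\<^esub> gg' ((i, j, k), x)) \<otimes>\<^bsub>G\<^esub>
          v ((i, k), x)" by simp
    then show ?thesis
      using ijk by (simp add: rv_closed E.G.m_assoc)
  qed
  ultimately show ?thesis
    by (simp add: coboundaries_relating_def)
qed

lemma iso_of_coboundary_of_iso: "iso_of_coboundary G H act N I U (r, v) = (\<Phi>, \<Psi>)"
proof -
  have "\<Phi> \<in> extensional (carrier G \<times> pts (cover2 N I U))"
    "\<Psi> \<in> extensional (pts (cover1 N I U) \<times> carrier H)"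
    using iso by (simp_all add: GH_isos_def E.Arr_R E.pts_ptot)
  then show ?thesis
    unfolding iso_of_coboundary_def prod.case
    by (intro arg_cong2[where f = Pair])
      (auto intro!: extensionalityI[OF restrict_extensional] simp: Phi_eq Psi_eq E.pts_cover1 E.pts_cover2)
qed

end

section \<open>From a coboundary to an isomorphism\<close>

context
  fixes r v
  assumes rv: "(r, v) \<in> coboundaries_relating G H \<rho> act N I U lam gg lam' gg'"
begin

lemma rv_ext: "r \<in> extensional (pts (cover1 N I U))" "v \<in> extensional (pts (cover2 N I U))"
  and smooth_rv: "smooth_map (cover1 N I U) (gmfd H) r" "smooth_map (cover2 N I U) (gmfd G) v"
  using rv by (simp_all add: coboundaries_relating_def coboundaries_def C_inf_def)

lemma r_in [simp]: "i \<in> I \<Longrightarrow> x \<in> U i \<Longrightarrow> r (i, x) \<in> carrier H"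
  using smooth_map_in_pts[OF smooth_rv(1), of "(i, x)"] by (simp add: E.pts_cover1)

lemma v_in [simp]: "i \<in> I \<Longrightarrow> j \<in> I \<Longrightarrow> x \<in> U i \<Longrightarrow> x \<in> U j \<Longrightarrow> v ((i, j), x) \<in> carrier G"
  using smooth_map_in_pts[OF smooth_rv(2), of "((i, j), x)"] by (simp add: E.pts_cover2)

lemma lam'_r:
  assumes "i \<in> I" "j \<in> I" "x \<in> U i" "x \<in> U j"
  shows "lam' ((i, j), x) \<otimes>\<^bsub>H\<^esub> r (j, x) = \<rho> (v ((i, j), x)) \<otimes>\<^bsub>H\<^esub> r (i, x) \<otimes>\<^bsub>H\<^esub> lam ((i, j), x)"
proof -
  have "lam' ((i, j), x) =
      \<rho> (v ((i, j), x)) \<otimes>\<^bsub>H\<^esub> r (i, x) \<otimes>\<^bsub>H\<^esub> lam ((i, j), x) \<otimes>\<^bsub>H\<^esub> inv\<^bsub>H\<^esub> (r (j, x))"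
    using rv assms by (simp add: coboundaries_relating_def)
  then show ?thesis using assms by (simp add: E.H.m_assoc)
qed

lemma gg'_v:
  assumes "i \<in> I" "j \<in> I" "k \<in> I" "x \<in> U i" "x \<in> U j" "x \<in> U k"
  shows "gg' ((i, j, k), x) \<otimes>\<^bsub>G\<^esub> v ((i, k), x) =
      act (lam' ((i, j), x)) (v ((j, k), x)) \<otimes>\<^bsub>G\<^esub> v ((i, j), x) \<otimes>\<^bsub>G\<^esub> act (r (i, x)) (gg ((i, j, k), x))"
  using rv assms by (simp add: coboundaries_relating_def)

text \<open>With equal indices both \<open>gg\<close> and \<open>gg'\<close> are neutral, so the
  second relation reads v = (action of \<open>lam'\<close> on v) times v. Cancelling v leaves an
  automorphism sending v to the neutral element.\<close>

lemma v_diag: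
  assumes "i \<in> I" "x \<in> U i"
  shows "v ((i, i), x) = \<one>\<^bsub>G\<^esub>"
proof -
  have "v ((i, i), x) = act (lam' ((i, i), x)) (v ((i, i), x)) \<otimes>\<^bsub>G\<^esub> v ((i, i), x)"
    using gg'_v[of i i i x] assms by (simp add: E.gg_unit E'.gg_unit)
  then have "act (lam' ((i, i), x)) (v ((i, i), x)) = act (lam' ((i, i), x)) \<one>\<^bsub>G\<^esub>"
    using assms E.G.r_cancel_one' by simp
  then show ?thesis
    using inj_onD[OF E.act_inj[of "lam' ((i, i), x)"]] assms by simp
qed

lemma coboundary_of_iso_of_coboundary:
  "coboundary_of_iso G H N I U (iso_of_coboundary G H act N I U (r, v)) = (r, v)"
  unfolding iso_of_coboundary_def coboundary_of_iso_def prod.case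
  by (intro arg_cong2[where f = Pair] extensionalityI[OF restrict_extensional] rv_ext)
    (auto simp: E.pts_cover1 E.pts_cover2)

lemma iso_of_coboundary_iso: "iso_of_coboundary G H act N I U (r, v) \<in> GH_isos G H E E'"
proof -
  define \<Phi> where "\<Phi> = fst (iso_of_coboundary G H act N I U (r, v))"
  define \<Psi> where "\<Psi> = snd (iso_of_coboundary G H act N I U (r, v))"
  have \<Phi>: "\<Phi> (g, ((i, j), x)) = (act (r (i, x)) g \<otimes>\<^bsub>G\<^esub> inv\<^bsub>G\<^esub> (v ((i, j), x)), ((i, j), x))"
    if "g \<in> carrier G" "i \<in> I" "j \<in> I" "x \<in> U i" "x \<in> U j" for g i j x
    using that by (simp add: \<Phi>_def iso_of_coboundary_def E.pts_cover2)
  have \<Psi>: "\<Psi> ((i, x), h) = ((i, x), r (i, x) \<otimes>\<^bsub>H\<^esub> h)"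
    if "i \<in> I" "x \<in> U i" "h \<in> carrier H" for i x h
    using that by (simp add: \<Psi>_def iso_of_coboundary_def E.pts_cover1)
  let ?s = "\<lambda>((i, j), x). (i, x)"
  \<comment> \<open>Obtained by solving g' = r(g) times the inverse of v for g, with r taken at the
    source of the arrow; \<open>?\<Psi>'\<close> undoes left translation by r.\<close>
  let ?\<Phi>' = "\<lambda>p. (act (inv\<^bsub>H\<^esub> (r (?s (snd p)))) (fst p \<otimes>\<^bsub>G\<^esub> v (snd p)), snd p)"
  let ?\<Psi>' = "\<lambda>p. (fst p, inv\<^bsub>H\<^esub> (r (fst p)) \<otimes>\<^bsub>H\<^esub> snd p)"
  note ms = manifold_GC2 manifold_C1H E.manifold_G E.manifold_H E.manifold_cover1 E.manifold_cover2
  have fst_GC2: "smooth_map GC2 (gmfd G) fst" and snd_GC2: "smooth_map GC2 (cover2 N I U) snd"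
    and fst_C1H: "smooth_map C1H (cover1 N I U) fst" and snd_C1H: "smooth_map C1H (gmfd H) snd"
    by (simp_all add: smooth_map_fst smooth_map_snd ms)
  have v_GC2: "smooth_map GC2 (gmfd G) (\<lambda>p. v (snd p))"
    by (rule smooth_map_compose[OF ms(1,6,3) snd_GC2 smooth_rv(2)])
  have "smooth_map GC2 (cover1 N I U) (\<lambda>p. ?s (snd p))"
    by (rule smooth_map_compose[OF ms(1,6,5) snd_GC2 E.smooth_src_cech])
  then have r_GC2: "smooth_map GC2 (gmfd H) (\<lambda>p. r (?s (snd p)))"
    by (rule smooth_map_compose[OF ms(1,5,4) _ smooth_rv(1)])
  have r_C1H: "smooth_map C1H (gmfd H) (\<lambda>p. r (fst p))"
    by (rule smooth_map_compose[OF ms(2,5,4) fst_C1H smooth_rv(1)])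
  have "smooth_map GC2 GC2 (\<lambda>p. (act (r (?s (snd p))) (fst p) \<otimes>\<^bsub>G\<^esub> inv\<^bsub>G\<^esub> (v (snd p)), snd p))"
    by (intro smooth_map_Pair E.smooth_mult_G E.smooth_act E.smooth_inv_G ms fst_GC2 snd_GC2 r_GC2 v_GC2)
  then have smooth_\<Phi>: "smooth_map GC2 GC2 \<Phi>"
    by (rule smooth_map_cong[OF ms(1,1)]) (auto simp: \<Phi> E.pts_cover2)
  have smooth_\<Phi>': "smooth_map GC2 GC2 ?\<Phi>'"
    by (intro smooth_map_Pair E.smooth_mult_G E.smooth_act E.smooth_inv_H ms fst_GC2 snd_GC2 r_GC2 v_GC2)
  have "smooth_map C1H C1H (\<lambda>p. (fst p, r (fst p) \<otimes>\<^bsub>H\<^esub> snd p))"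
    by (intro smooth_map_Pair E.smooth_mult_H ms fst_C1H snd_C1H r_C1H)
  then have smooth_\<Psi>: "smooth_map C1H C1H \<Psi>"
    by (rule smooth_map_cong[OF ms(2,2)]) (auto simp: \<Psi> E.pts_cover1)
  have smooth_\<Psi>': "smooth_map C1H C1H ?\<Psi>'"
    by (intro smooth_map_Pair E.smooth_mult_H E.smooth_inv_H ms fst_C1H snd_C1H r_C1H)
  \<comment> \<open>\<open>act_mult\<close> is withheld so that the action is not distributed over
    products and \<open>act_inv_cancel\<close> can match.\<close>
  have diffeo_\<Phi>: "diffeo (arrows E.R) (arrows E'.R) \<Phi>"
    by (rule diffeoI[OF E.manifold_arrows E'.manifold_arrows, where g = ?\<Phi>'])
      (auto simp: smooth_arrows_iff smooth_arrows_iff' smooth_\<Phi> smooth_\<Phi>' E.Arr_R E'.Arr_R E.pts_cover2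
        \<Phi> E.G.m_assoc E.act_inv_cancel simp del: E.act_mult)
  have diffeo_\<Psi>: "diffeo (ptot E) (ptot E') \<Psi>"
    by (rule diffeoI[OF E.manifold_ptot E'.manifold_ptot, where g = ?\<Psi>'])
      (auto simp: smooth_ptot_iff smooth_ptot_iff' smooth_\<Psi> smooth_\<Psi>' E.pts_ptot E'.pts_ptot E.pts_cover1 \<Psi>)
  have mult: "\<Phi> (gprod E.R (g, ((i, j), x)) (g', ((j, k), x))) =
      gprod E'.R (\<Phi> (g, ((i, j), x))) (\<Phi> (g', ((j, k), x)))"
    if "g \<in> carrier G" "g' \<in> carrier G" and ijk: "i \<in> I" "j \<in> I" "k \<in> I" "x \<in> U i" "x \<in> U j" "x \<in> U k"
    for g g' i j k x
  proof -
    let ?a = "v ((i, j), x)" and ?b = "act (lam' ((i, j), x)) (v ((j, k), x))" and ?c = "v ((i, k), x)"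
      and ?X = "act (r (i, x)) (gg ((i, j, k), x))" and ?l = "act (r (i, x)) (act (lam ((i, j), x)) g')"
    have "gg' ((i, j, k), x) = gg' ((i, j, k), x) \<otimes>\<^bsub>G\<^esub> ?c \<otimes>\<^bsub>G\<^esub> inv\<^bsub>G\<^esub> ?c"
      using ijk by (simp add: E.G.m_assoc)
    then have gg': "gg' ((i, j, k), x) = ?b \<otimes>\<^bsub>G\<^esub> ?a \<otimes>\<^bsub>G\<^esub> ?X \<otimes>\<^bsub>G\<^esub> inv\<^bsub>G\<^esub> ?c"
      using ijk by (simp only: gg'_v)
    \<comment> \<open>In the product formula for \<open>E'\<close> this term follows the inverse of
      \<open>?a\<close>. As a conjugate by \<open>?a\<close> it cancels that inverse, and its own
      trailing inverses of \<open>?a\<close> and \<open>?b\<close> cancel against the start of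
      \<open>gg'\<close>.\<close>
    have "act (lam' ((i, j), x)) (act (r (j, x)) g') = act (lam' ((i, j), x) \<otimes>\<^bsub>H\<^esub> r (j, x)) g'"
      using that by (simp add: E.act_comp)
    also have "\<dots> = act (\<rho> ?a) ?l"
      using that by (simp add: lam'_r E.act_comp)
    also have "\<dots> = ?a \<otimes>\<^bsub>G\<^esub> ?l \<otimes>\<^bsub>G\<^esub> inv\<^bsub>G\<^esub> ?a"
      using that by (simp add: E.act_rho)
    finally show ?thesis
      using that by (simp add: E.gprod_eq E'.gprod_eq \<Phi> gg' E.G.m_assoc)
  qed
  have equiv: "\<Psi> (ract E (lact E (g, ((i, j), x)) ((j, x), k)) h) =
      ract E' (lact E' (\<Phi> (g, ((i, j), x))) (\<Psi> ((j, x), k))) h"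
    if "g \<in> carrier G" "h \<in> carrier H" "k \<in> carrier H" and ij: "i \<in> I" "j \<in> I" "x \<in> U i" "x \<in> U j"
    for g h k i j x
  proof -
    let ?a = "v ((i, j), x)"
    \<comment> \<open>The first relation with a trailing factor \<open>y\<close>, to match the
      right-nested products produced by \<open>m_assoc\<close>.\<close>
    have "lam' ((i, j), x) \<otimes>\<^bsub>H\<^esub> (r (j, x) \<otimes>\<^bsub>H\<^esub> y) = \<rho> ?a \<otimes>\<^bsub>H\<^esub> (r (i, x) \<otimes>\<^bsub>H\<^esub> (lam ((i, j), x) \<otimes>\<^bsub>H\<^esub> y))"
      if "y \<in> carrier H" for y
    proof -
      have "lam' ((i, j), x) \<otimes>\<^bsub>H\<^esub> (r (j, x) \<otimes>\<^bsub>H\<^esub> y) = lam' ((i, j), x) \<otimes>\<^bsub>H\<^esub> r (j, x) \<otimes>\<^bsub>H\<^esub> y"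
        using ij that by (simp add: E.H.m_assoc)
      also have "\<dots> = \<rho> ?a \<otimes>\<^bsub>H\<^esub> r (i, x) \<otimes>\<^bsub>H\<^esub> lam ((i, j), x) \<otimes>\<^bsub>H\<^esub> y"
        using ij by (simp only: lam'_r)
      finally show ?thesis using ij that by (simp add: E.H.m_assoc)
    qed
    then show ?thesis
      using that by (simp add: E.lact_eq E'.lact_eq \<Phi> \<Psi> E.rho_act E.H.m_assoc)
  qed
  have "(\<Phi>, \<Psi>) \<in> GH_isos G H E E'"
    unfolding GH_isos_def mem_Collect_eq prod.case groupoid_morphism_def
  proof (intro conjI diffeo_\<Phi> diffeo_\<Psi>)
    show "\<Phi> \<in> extensional (Arr E.R)" "\<Psi> \<in> extensional (pts (ptot E))"
      by (simp_all add: \<Phi>_def \<Psi>_def iso_of_coboundary_def E.Arr_R E.pts_ptot)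
    show "objects E.R = objects E'.R" by (simp add: E.objects_R E'.objects_R)
    show "smooth_map (arrows E.R) (arrows E'.R) \<Phi>" by (simp add: smooth_arrows_iff smooth_\<Phi>)
    show "\<forall>x\<in>Arr E.R. src E'.R (\<Phi> x) = src E.R x \<and> tgt E'.R (\<Phi> x) = tgt E.R x"
      by (auto simp: E.Arr_R E.pts_cover2 \<Phi>)
    \<comment> \<open>Here and for \<open>chi\<close> below, \<open>v_diag\<close> removes the
      inverse of v from \<Phi> over a unit of the base groupoid.\<close>
    show "\<forall>m\<in>Obj E.R. \<Phi> (ident E.R m) = ident E'.R m"
      by (auto simp: E.objects_R E.pts_cover1 E.ident_R E'.ident_R \<Phi> v_diag)
    show "\<forall>x\<in>Arr E.R. \<forall>y\<in>Arr E.R. tgt E.R x = src E.R y \<longrightarrow>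
        \<Phi> (gprod E.R x y) = gprod E'.R (\<Phi> x) (\<Phi> y)"
      by (auto simp: E.Arr_R E.pts_cover2 mult)
    show "\<forall>x\<in>Arr E.R. eproj E' (\<Phi> x) = eproj E x"
      by (auto simp: E.Arr_R E.pts_cover2 \<Phi> E.eproj_eq E'.eproj_eq)
    show "\<forall>p\<in>pts (ptot E). bproj E' (\<Psi> p) = bproj E p"
      by (auto simp: E.pts_ptot E.pts_cover1 \<Psi>)
    show "\<forall>x\<in>Arr E.R. \<forall>p\<in>pts (ptot E). \<forall>h\<in>carrier H. tgt E.R x = bproj E p \<longrightarrow>
        \<Psi> (ract E (lact E x p) h) = ract E' (lact E' (\<Phi> x) (\<Psi> p)) h"
      by (auto simp: E.Arr_R E.pts_cover2 E.pts_ptot E.pts_cover1 equiv)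
    show "\<forall>p\<in>pts (ptot E). chi E' (\<Psi> p) = (\<lambda>g\<in>carrier G. \<Phi> (chi E p g))"
      by (auto simp: E.pts_ptot E.pts_cover1 \<Psi> \<Phi> E.chi_eq E'.chi_eq E.act_comp v_diag)
  qed
  then show ?thesis by (simp add: \<Phi>_def \<Psi>_def)
qed

end

lemma isos_bij_coboundaries:
  "bij_betw (coboundary_of_iso G H N I U)
      (GH_isos G H E E') (coboundaries_relating G H \<rho> act N I U lam gg lam' gg')"
  "bij_betw (iso_of_coboundary G H act N I U)
      (coboundaries_relating G H \<rho> act N I U lam gg lam' gg') (GH_isos G H E E')"
  "z \<in> GH_isos G H E E' \<Longrightarrow> iso_of_coboundary G H act N I U (coboundary_of_iso G H N I U z) = z"
  "c \<in> coboundaries_relating G H \<rho> act N I U lam gg lam' gg' \<Longrightarrow>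
    coboundary_of_iso G H N I U (iso_of_coboundary G H act N I U c) = c"
proof -
  let ?c = "coboundary_of_iso G H N I U" and ?i = "iso_of_coboundary G H act N I U"
    and ?A = "GH_isos G H E E'" and ?B = "coboundaries_relating G H \<rho> act N I U lam gg lam' gg'"
  have c: "?c z \<in> ?B \<and> ?i (?c z) = z" if "z \<in> ?A" for z
    using coboundary_of_iso_relates iso_of_coboundary_of_iso that by (metis surj_pair)
  have i: "?i b \<in> ?A \<and> ?c (?i b) = b" if "b \<in> ?B" for b
    using iso_of_coboundary_iso coboundary_of_iso_of_coboundary that by (metis surj_pair)
  show "bij_betw ?c ?A ?B" "bij_betw ?i ?B ?A"
    using c i by (auto intro!: bij_betw_byWitness[where f = ?c and f' = ?i]
        bij_betw_byWitness[where f = ?i and f' = ?c])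
  show "z \<in> ?A \<Longrightarrow> ?i (?c z) = z" "b \<in> ?B \<Longrightarrow> ?c (?i b) = b" for b
    using c i by blast+
qed

end

text \<open>\<open>coboundary_of_iso\<close> keeps only one component of each value of \<Psi> and
  \<Phi>. The first conjunct adds that the discarded components are the expected base point and Cech
  arrow, so the defining equations of r and v hold in full.\<close>

theorem proposition2p17:
  fixes N :: "('n, 'en::real_normed_vector) mfd"
    and I :: "'i set" and U :: "'i \<Rightarrow> 'n set"
    and G :: "('g, 'eg::real_normed_vector) lie_grp"
    and H :: "('h, 'eh::real_normed_vector) lie_grp"
    and \<rho> :: "'g \<Rightarrow> 'h" and act :: "'h \<Rightarrow> 'g \<Rightarrow> 'g"
    and E E' :: "('i, 'n, 'en, 'g, 'eg, 'h, 'eh) cech_ext"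
    and lam lam' :: "('i \<times> 'i) \<times> 'n \<Rightarrow> 'h"
    and gg gg' :: "('i \<times> 'i \<times> 'i) \<times> 'n \<Rightarrow> 'g"
  assumes "manifold N" and "open_cover N I U"
    and "crossed_module G H \<rho> act"
    and "adapted G H \<rho> act N I U E" and "adapted G H \<rho> act N I U E'"
    and "cocycle G H \<rho> act N I U lam gg" and "associated G H I U E lam gg"
    and "cocycle G H \<rho> act N I U lam' gg'" and "associated G H I U E' lam' gg'"
  shows "(\<forall>(\<Phi>, \<Psi>)\<in>GH_isos G H E E'. \<forall>r v. (r, v) = coboundary_of_iso G H N I U (\<Phi>, \<Psi>) \<longrightarrow>
              (\<forall>i\<in>I. \<forall>x\<in>U i. \<Psi> ((i, x), \<one>\<^bsub>H\<^esub>) = ((i, x), r (i, x))) \<and>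
              (\<forall>i\<in>I. \<forall>j\<in>I. \<forall>x\<in>U i \<inter> U j.
                 \<Phi> (\<one>\<^bsub>G\<^esub>, ((i, j), x)) = (inv\<^bsub>G\<^esub> (v ((i, j), x)), ((i, j), x)))) \<and>
         (bij_betw (coboundary_of_iso G H N I U)
              (GH_isos G H E E') (coboundaries_relating G H \<rho> act N I U lam gg lam' gg')) \<and>
         (bij_betw (iso_of_coboundary G H act N I U)
              (coboundaries_relating G H \<rho> act N I U lam gg lam' gg') (GH_isos G H E E')) \<and>
         (\<forall>z\<in>GH_isos G H E E'.
              iso_of_coboundary G H act N I U (coboundary_of_iso G H N I U z) = z) \<and>
         (\<forall>c\<in>coboundaries_relating G H \<rho> act N I U lam gg lam' gg'.
              coboundary_of_iso G H N I U (iso_of_coboundary G H act N I U c) = c)"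
proof -
  interpret adapted_pair G H \<rho> act N I U E lam gg E' lam' gg'
    using assms by unfold_locales
  have "\<forall>(\<Phi>, \<Psi>)\<in>GH_isos G H E E'. \<forall>r v. (r, v) = coboundary_of_iso G H N I U (\<Phi>, \<Psi>) \<longrightarrow>
      (\<forall>i\<in>I. \<forall>x\<in>U i. \<Psi> ((i, x), \<one>\<^bsub>H\<^esub>) = ((i, x), r (i, x))) \<and>
      (\<forall>i\<in>I. \<forall>j\<in>I. \<forall>x\<in>U i \<inter> U j.
         \<Phi> (\<one>\<^bsub>G\<^esub>, ((i, j), x)) = (inv\<^bsub>G\<^esub> (v ((i, j), x)), ((i, j), x)))"
    using Psi_unit Phi_unit by blast
  then show ?thesis
    using isos_bij_coboundaries by blast
qed

end
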